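(* Let $M,N\in\mathbb{N}$ (positive integers) and $0\leq\alpha_1<\alpha_2<\ldots<\alpha_{MN}<N$. Then there exist constants $c,C>0$ such that for all $H\in OPW([0,N]\times[-\tfrac{M}{2},\tfrac{M}{2}])$, $$c\,\|H\|_{HS}^2\leq\sum_{j=1}^{MN}\Big\|H\Big(\sum_{n\in\mathbb{Z}}\delta_{nN+\alpha_j}\Big)\Big\|_{L^2(\mathbb{R})}^2\leq C\,\|H\|_{HS}^2 .$$
   Context: Hilbert-Schmidt operators: $HS(L^2(\mathbb{R}))$ is the space of operators $Hf(x)=\int\kappa_H(x,t)f(t)\,dt$ with kernel $\kappa_H\in L^2(\mathbb{R}^2)$, and $\|H\|_{HS}=\|\kappa_H\|_{L^2}$. The time-varying impulse response is $h_H(t,x)=\kappa_H(x,x-t)$, so that $Hf(x)=\int h_H(t,x)f(x-t)\,dt$, and the spreading function is $\eta_H(t,\nu)=\int h_H(t,x)e^{-2\pi i x\nu}\,dx$ (in the $L^2$ sense); it is the symplectic Fourier transform of the Kohn-Nirenberg symbol of $H$. For $S\subseteq\mathbb{R}^2$, $OPW(S)=\{H\in HS(L^2(\mathbb{R})): \operatorname{supp}\eta_H\subseteq S\}$. For $S$ compact, every $H\in OPW(S)$ extends to a bounded operator from $S_0'(\mathbb{R})$ (the dual of the Feichtinger algebra) to $L^2(\mathbb{R})$; on $f=\sum_k c_k\delta_{\lambda_k}$ it acts by $(Hf)(x)=\sum_k c_k\kappa_H(x,\lambda_k)=\sum_k c_kh_H(x-\lambda_k,x)$, where for a.e. $t$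 the function $h_H(t,\cdot)$ is taken to be its continuous representative $x\mapsto\int\eta_H(t,\nu)e^{2\pi i x\nu}\,d\nu$. *)

theory Defs
  imports "HOL-Analysis.Analysis"
begin

text \<open>
  Elements of \<open>L\<^sup>2\<close> are represented by Borel functions, with equality almost everywhere.
\<close>

definition L2 :: "'a measure \<Rightarrow> ('a \<Rightarrow> complex) set"
  where "L2 M = {f \<in> borel_measurable M. integrable M (\<lambda>x. (cmod (f x))\<^sup>2)}"

definition L2_norm :: "'a measure \<Rightarrow> ('a \<Rightarrow> complex) \<Rightarrow> real"
  where "L2_norm M f = sqrt (LINT x|M. (cmod (f x))\<^sup>2)"

type_synonym operator = "(real \<Rightarrow> complex) \<Rightarrow> (real \<Rightarrow> complex)"

definition has_kernel :: "operator \<Rightarrow> (real \<times> real \<Rightarrow> complex) \<Rightarrow> bool"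
  where "has_kernel H \<kappa> \<longleftrightarrow> \<kappa> \<in> L2 lborel \<and>
    (\<forall>f \<in> L2 lborel. H f \<in> L2 lborel \<and>
      (AE x in lborel. H f x = (LINT t|lborel. \<kappa> (x, t) * f t)))"

text \<open>
  The values of \<open>H\<close> outside \<open>L\<^sup>2\<close> play no role here. The action on the distributions needed
  below is \<open>apply_deltas\<close>.
\<close>

definition HS :: "operator set"
  where "HS = {H. \<exists>\<kappa>. has_kernel H \<kappa>}"

text \<open>The kernel of an operator in \<open>HS\<close> is unique up to a null set.\<close>

definition kernel :: "operator \<Rightarrow> real \<times> real \<Rightarrow> complex"
  where "kernel H = (SOME \<kappa>. has_kernel H \<kappa>)"

definition HS_norm :: "operator \<Rightarrow> real"
  where "HS_norm H = L2_norm lborel (kernel H)"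

definition impulse_response :: "operator \<Rightarrow> real \<Rightarrow> real \<Rightarrow> complex"
  where "impulse_response H t x = kernel H (x, x - t)"

text \<open>
  The Fourier transform on \<open>L\<^sup>2\<close>: \<open>g\<close> is the \<open>L\<^sup>2\<close>-limit of the transforms of the truncations
  of \<open>f\<close> to \<open>[-R, R]\<close>.
\<close>

definition has_L2_fourier :: "(real \<Rightarrow> complex) \<Rightarrow> (real \<Rightarrow> complex) \<Rightarrow> bool"
  where "has_L2_fourier f g \<longleftrightarrow> f \<in> L2 lborel \<and> g \<in> L2 lborel \<and>
    ((\<lambda>R. \<integral>\<^sup>+\<nu>. ennreal ((cmod (g \<nu> -
        (LINT x:{-R..R}|lborel. f x * exp (- 2 * of_real pi * \<i> * of_real x * of_real \<nu>))))\<^sup>2)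
      \<partial>lborel) \<longlongrightarrow> 0) at_top"

definition has_spreading_function :: "operator \<Rightarrow> (real \<times> real \<Rightarrow> complex) \<Rightarrow> bool"
  where "has_spreading_function H \<eta> \<longleftrightarrow> \<eta> \<in> L2 lborel \<and>
    (AE t in lborel. has_L2_fourier (impulse_response H t) (\<lambda>\<nu>. \<eta> (t, \<nu>)))"

text \<open>
  By Plancherel's theorem every operator in \<open>HS\<close> has a spreading function, unique up to a
  null set.
\<close>

definition spreading_function :: "operator \<Rightarrow> real \<times> real \<Rightarrow> complex"
  where "spreading_function H = (SOME \<eta>. has_spreading_function H \<eta>)"

text \<open>
  The support of a function defined up to null sets: the complement of the largest open set
  on which it vanishes almost everywhere.
\<close>

definition ess_support :: "(real \<times> real \<Rightarrow> complex) \<Rightarrow> (real \<times> real) set"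
  where "ess_support \<eta> =
    - \<Union>{U. open U \<and> (AE z in lborel. z \<in> U \<longrightarrow> \<eta> z = 0)}"

definition OPW :: "(real \<times> real) set \<Rightarrow> operator set"
  where "OPW S = {H \<in> HS. \<exists>\<eta>. has_spreading_function H \<eta> \<and> ess_support \<eta> \<subseteq> S}"

text \<open>
  For \<open>H\<close> in \<open>OPW S\<close> with \<open>S\<close> compact and almost every \<open>t\<close>, the integrand is integrable and
  this is the continuous representative of \<open>impulse_response H t\<close>.
\<close>

definition cont_impulse_response :: "operator \<Rightarrow> real \<Rightarrow> real \<Rightarrow> complex"
  where "cont_impulse_response H t x =
    (LINT \<nu>|lborel. spreading_function H (t, \<nu>) * exp (2 * of_real pi * \<i> * of_real x * of_real \<nu>))"

text \<open>
  The value of (the extension of) \<open>H\<close> at the distribution \<open>\<Sum>k\<in>K. c k * \<delta>\<close> with the \<open>k\<close>-th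
  point mass located at \<open>p k\<close>. For almost every \<open>x\<close> only finitely many terms are nonzero when
  the spreading function has compact support and the points \<open>p k\<close> are locally finite.
\<close>

definition apply_deltas ::
    "operator \<Rightarrow> 'k set \<Rightarrow> ('k \<Rightarrow> complex) \<Rightarrow> ('k \<Rightarrow> real) \<Rightarrow> real \<Rightarrow> complex"
  where "apply_deltas H K c p x =
    (\<Sum>\<^sub>\<infinity>k\<in>K. c k * cont_impulse_response H (x - p k) x)"

text \<open>The value at \<open>\<Sum>n. \<delta>\<close> with point masses at \<open>n * T + a\<close> for integers \<open>n\<close>.\<close>

definition apply_shifted_comb :: "operator \<Rightarrow> real \<Rightarrow> real \<Rightarrow> real \<Rightarrow> complex"
  where "apply_shifted_comb H T a =
    apply_deltas H (UNIV :: int set) (\<lambda>n. 1) (\<lambda>n. of_int n * T + a)"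

end

theory Submission
  imports Defs
begin

text \<open>
  For almost every \<open>t\<close>, write \<open>F = \<eta> (t, \<cdot>)\<close>, which lives on the band \<open>[-M/2, M/2]\<close>, and
  \<open>h t\<close> for its inverse Fourier transform. At \<open>x = t + n N + \<alpha> j\<close> with \<open>0 \<le> t < N\<close> the comb
  response reduces to the single term \<open>h t (t + n N + \<alpha> j)\<close>, so the sum of the squared norms is
  the integral over \<open>t\<close> of \<open>\<Sum>j n. |h t (t + n N + \<alpha> j)|\<^sup>2\<close>. Folding the band into \<open>M N\<close>
  pieces of length \<open>1/N\<close> and applying Parseval for Fourier series turns this into the squared norm of a
  vector of \<open>M N\<close> translates of \<open>F\<close> multiplied by the Vandermonde matrix with the distinct nodes
  \<open>exp (2 \<pi> i \<alpha> j / N)\<close>, which is comparable to \<open>\<parallel>F\<parallel>\<^sup>2\<close> uniformly in \<open>t\<close>. Finally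
  \<open>\<parallel>H\<parallel>\<close> is the norm of \<open>\<eta>\<close> by Plancherel, which itself follows from Parseval for Fourier series by
  averaging over the frequency shifts.
\<close>

subsection \<open>Density of polynomials in \<open>L\<^sup>2\<close>\<close>

text \<open>The obstacle is uniformity: the constants may depend on \<open>M\<close>,
  \<open>N\<close> and \<open>\<alpha>\<close>, but not on \<open>H\<close> or on \<open>t\<close>.
  The number \<open>M N\<close> is critical: a band of length \<open>M\<close> cut into pieces of
  length \<open>1/N\<close> gives a square matrix, so the lower bound rests on its inverse. It is
  invertible because 0 \<le> \<open>\<alpha> j\<close> < \<open>N\<close> keeps the angles 2 \<pi>
  \<open>\<alpha> j\<close> / \<open>N\<close> within one turn, so distinct shifts give distinct
  nodes. The shift by \<open>t\<close> only multiplies each piece by a number of modulus 1 and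
  leaves the matrix alone. A second difficulty is that \<open>spreading_function\<close> is a
  \<open>SOME\<close> choice, known only up to null sets; the support condition reaches the chosen
  function through uniqueness of the L2 Fourier transform. Norms are mostly kept as nonnegative
  integrals in \<open>ennreal\<close>, so that sums and integrals can be exchanged before anything
  is known to be finite. Completeness of the exponentials comes from Stone-Weierstrass and a measure
  carried by the circle.\<close>

lemma cmod_diff_square_le: "(cmod (x - y))\<^sup>2 \<le> 2 * (cmod (x - z))\<^sup>2 + 2 * (cmod (z - y))\<^sup>2"
proof -
  have "cmod (x - y) \<le> cmod (x - z) + cmod (z - y)"
    by (metis diff_add_cancel add_diff_eq norm_triangle_ineq)
  then have "(cmod (x - y))\<^sup>2 \<le> (cmod (x - z) + cmod (z - y))\<^sup>2"
    by (simp add: power_mono)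
  also have "\<dots> \<le> 2 * (cmod (x - z))\<^sup>2 + 2 * (cmod (z - y))\<^sup>2"
    using sum_squares_bound[of "cmod (x - z)" "cmod (z - y)"] by (simp add: power2_sum)
  finally show ?thesis .
qed

lemma nn_integral_cmod_diff_square_le:
  assumes [measurable]: "f \<in> borel_measurable M" "g \<in> borel_measurable M" "h \<in> borel_measurable M"
  shows "(\<integral>\<^sup>+x. (cmod (f x - h x))\<^sup>2 \<partial>M)
    \<le> 2 * (\<integral>\<^sup>+x. (cmod (f x - g x))\<^sup>2 \<partial>M) + 2 * (\<integral>\<^sup>+x. (cmod (g x - h x))\<^sup>2 \<partial>M)"
proof -
  have "(\<integral>\<^sup>+x. (cmod (f x - h x))\<^sup>2 \<partial>M)
    \<le> (\<integral>\<^sup>+x. 2 * ennreal ((cmod (f x - g x))\<^sup>2) + 2 * ennreal ((cmod (g x - h x))\<^sup>2) \<partial>M)"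
    using cmod_diff_square_le
    by (intro nn_integral_mono) (auto simp flip: ennreal_plus ennreal_mult' simp: ennreal_mult'[symmetric]
        ennreal_numeral[symmetric] simp del: ennreal_numeral)
  also have "\<dots> = 2 * (\<integral>\<^sup>+x. (cmod (f x - g x))\<^sup>2 \<partial>M) + 2 * (\<integral>\<^sup>+x. (cmod (g x - h x))\<^sup>2 \<partial>M)"
    by (simp add: nn_integral_add nn_integral_cmult)
  finally show ?thesis .
qed

text \<open>Membership in the L2 closure of the polynomials. The error is a nonnegative integral, so
  no integrability of \<open>f\<close> or \<open>p\<close> has to be carried along.\<close>

definition L2_polynomial_limit :: "'a::euclidean_space measure \<Rightarrow> ('a \<Rightarrow> complex) \<Rightarrow> bool"
  where "L2_polynomial_limit M f \<longleftrightarrow> f \<in> borel_measurable M \<and>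
    (\<forall>e>0. \<exists>p. polynomial_function p \<and> (\<integral>\<^sup>+x. (cmod (f x - p x))\<^sup>2 \<partial>M) < ennreal e)"

lemma polynomial_function_borel_measurable:
  fixes p :: "'a::euclidean_space \<Rightarrow> complex"
  assumes "polynomial_function p" "sets M = sets borel"
  shows "p \<in> borel_measurable M"
  using borel_measurable_continuous_onI[OF continuous_on_polymonial_function[OF assms(1)]]
  by (simp add: measurable_cong_sets[OF assms(2) refl])

text \<open>The triangle inequality for squares costs a factor 2, hence two errors below
  \<open>e/4\<close>.\<close>

lemma L2_polynomial_limit_closed:
  fixes M :: "'a::euclidean_space measure"
  assumes sets: "sets M = sets borel" and [measurable]: "f \<in> borel_measurable M"
    and "\<And>e. e > 0 \<Longrightarrow> \<exists>g. L2_polynomial_limit M g \<and> (\<integral>\<^sup>+x. (cmod (f x - g x))\<^sup>2 \<partial>M) < ennreal e"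
  shows "L2_polynomial_limit M f"
  unfolding L2_polynomial_limit_def
proof (intro conjI allI impI)
  fix e :: real assume "e > 0"
  then obtain g where g: "L2_polynomial_limit M g" "(\<integral>\<^sup>+x. (cmod (f x - g x))\<^sup>2 \<partial>M) < ennreal (e/4)"
    using assms(3)[of "e/4"] by auto
  obtain p where p: "polynomial_function p" "(\<integral>\<^sup>+x. (cmod (g x - p x))\<^sup>2 \<partial>M) < ennreal (e/4)"
    using g(1) \<open>e > 0\<close> unfolding L2_polynomial_limit_def by (meson zero_less_divide_iff zero_less_numeral)
  have [measurable]: "g \<in> borel_measurable M" "p \<in> borel_measurable M"
    using g p polynomial_function_borel_measurable[OF p(1) sets]
    by (auto simp: L2_polynomial_limit_def)
  have "(\<integral>\<^sup>+x. (cmod (f x - p x))\<^sup>2 \<partial>M)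
      \<le> 2 * (\<integral>\<^sup>+x. (cmod (f x - g x))\<^sup>2 \<partial>M) + 2 * (\<integral>\<^sup>+x. (cmod (g x - p x))\<^sup>2 \<partial>M)"
    by (rule nn_integral_cmod_diff_square_le) auto
  also have "\<dots> < 2 * ennreal (e/4) + 2 * ennreal (e/4)"
    using g(2) p(2) by (intro add_strict_mono ennreal_mult_strict_left_mono) auto
  also have "\<dots> = ennreal e"
    using \<open>e > 0\<close> by (simp flip: ennreal_plus ennreal_numeral ennreal_mult')
  finally show "\<exists>p. polynomial_function p \<and> (\<integral>\<^sup>+x. (cmod (f x - p x))\<^sup>2 \<partial>M) < ennreal e"
    using p(1) by blast
qed auto

lemma L2_polynomial_limit_add:
  fixes M :: "'a::euclidean_space measure"
  assumes sets: "sets M = sets borel" and f: "L2_polynomial_limit M f" and g: "L2_polynomial_limit M g"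
  shows "L2_polynomial_limit M (\<lambda>x. f x + g x)"
  unfolding L2_polynomial_limit_def
proof (intro conjI allI impI)
  have [measurable]: "f \<in> borel_measurable M" "g \<in> borel_measurable M"
    using f g by (auto simp: L2_polynomial_limit_def)
  show "(\<lambda>x. f x + g x) \<in> borel_measurable M" by simp
  fix e :: real assume "e > 0"
  then have "e/4 > 0" by simp
  then obtain p q where p: "polynomial_function p" "(\<integral>\<^sup>+x. (cmod (f x - p x))\<^sup>2 \<partial>M) < ennreal (e/4)"
    and q: "polynomial_function q" "(\<integral>\<^sup>+x. (cmod (g x - q x))\<^sup>2 \<partial>M) < ennreal (e/4)"
    using f g unfolding L2_polynomial_limit_def by meson
  have [measurable]: "p \<in> borel_measurable M" "q \<in> borel_measurable M"
    using p q polynomial_function_borel_measurable[OF _ sets] by auto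
  have "(\<integral>\<^sup>+x. (cmod ((f x + g x) - (p x + q x)))\<^sup>2 \<partial>M)
      \<le> 2 * (\<integral>\<^sup>+x. (cmod ((f x + g x) - (p x + g x)))\<^sup>2 \<partial>M)
        + 2 * (\<integral>\<^sup>+x. (cmod ((p x + g x) - (p x + q x)))\<^sup>2 \<partial>M)"
    by (rule nn_integral_cmod_diff_square_le) auto
  also have "\<dots> = 2 * (\<integral>\<^sup>+x. (cmod (f x - p x))\<^sup>2 \<partial>M) + 2 * (\<integral>\<^sup>+x. (cmod (g x - q x))\<^sup>2 \<partial>M)"
    by simp
  also have "\<dots> < 2 * ennreal (e/4) + 2 * ennreal (e/4)"
    using p(2) q(2) by (intro add_strict_mono ennreal_mult_strict_left_mono) auto
  also have "\<dots> = ennreal e"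
    using \<open>e > 0\<close> by (simp flip: ennreal_plus ennreal_numeral ennreal_mult')
  finally show "\<exists>p. polynomial_function p \<and> (\<integral>\<^sup>+x. (cmod (f x + g x - p x))\<^sup>2 \<partial>M) < ennreal e"
    using p(1) q(1) by (intro exI[of _ "\<lambda>x. p x + q x"]) auto
qed

lemma L2_polynomial_limit_cmult:
  fixes M :: "'a::euclidean_space measure"
  assumes sets: "sets M = sets borel" and f: "L2_polynomial_limit M f"
  shows "L2_polynomial_limit M (\<lambda>x. c * f x)"
  unfolding L2_polynomial_limit_def
proof (intro conjI allI impI)
  have [measurable]: "f \<in> borel_measurable M"
    using f by (auto simp: L2_polynomial_limit_def)
  show "(\<lambda>x. c * f x) \<in> borel_measurable M" by simp
  fix e :: real assume "e > 0"
  \<comment> \<open>The summand 1 covers \<open>c = 0\<close> and makes the final inequality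
    strict.\<close>
  define d where "d = e / ((cmod c)\<^sup>2 + 1)"
  have "(cmod c)\<^sup>2 + 1 > 0" by (smt (verit) zero_le_power2)
  then have "d > 0" using \<open>e > 0\<close> by (simp add: d_def)
  then obtain p where p: "polynomial_function p" "(\<integral>\<^sup>+x. (cmod (f x - p x))\<^sup>2 \<partial>M) < ennreal d"
    using f unfolding L2_polynomial_limit_def by meson
  have [measurable]: "p \<in> borel_measurable M"
    using p polynomial_function_borel_measurable[OF _ sets] by auto
  have "(\<integral>\<^sup>+x. (cmod (c * f x - c * p x))\<^sup>2 \<partial>M)
      = (\<integral>\<^sup>+x. ennreal ((cmod c)\<^sup>2) * ennreal ((cmod (f x - p x))\<^sup>2) \<partial>M)"
    by (intro nn_integral_cong)
      (simp flip: ennreal_mult' right_diff_distrib add: norm_mult power_mult_distrib)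
  also have "\<dots> = ennreal ((cmod c)\<^sup>2) * (\<integral>\<^sup>+x. (cmod (f x - p x))\<^sup>2 \<partial>M)"
    by (simp add: nn_integral_cmult)
  also have "\<dots> \<le> ennreal ((cmod c)\<^sup>2) * ennreal d"
    using p(2) by (intro mult_left_mono) auto
  also have "\<dots> < ennreal e"
    using \<open>e > 0\<close> \<open>d > 0\<close> \<open>(cmod c)\<^sup>2 + 1 > 0\<close>
    by (simp flip: ennreal_mult' add: ennreal_less_iff d_def field_simps)
  finally show "\<exists>p. polynomial_function p \<and> (\<integral>\<^sup>+x. (cmod (c * f x - p x))\<^sup>2 \<partial>M) < ennreal e"
    using p(1) bounded_linear_compose[OF _ bounded_linear_mult_right[of c]]
    by (intro exI[of _ "\<lambda>x. c * p x"]) (auto simp: polynomial_function_def o_def)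
qed

lemma L2_polynomial_limit_sum:
  fixes M :: "'a::euclidean_space measure"
  assumes sets: "sets M = sets borel" and "\<And>i. i \<in> I \<Longrightarrow> L2_polynomial_limit M (f i)" "finite I"
  shows "L2_polynomial_limit M (\<lambda>x. \<Sum>i\<in>I. f i x)"
  using assms(3,2)
proof (induction I rule: finite_induct)
  case empty
  have "\<And>e. e > 0 \<Longrightarrow> \<exists>p. polynomial_function p \<and> (\<integral>\<^sup>+x. (cmod ((0::complex) - p x))\<^sup>2 \<partial>M) < ennreal e"
    by (intro exI[of _ "\<lambda>x. 0"]) auto
  then show ?case by (simp add: L2_polynomial_limit_def)
next
  case (insert i I)
  then show ?case using L2_polynomial_limit_add[OF sets, of "f i" "\<lambda>x. \<Sum>i\<in>I. f i x"] by simp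
qed

text \<open>Dominated convergence with the majorant \<open>4 * (B x)\<^sup>2\<close> turns pointwise
  limits into L2 limits. Every passage to the limit below, from cutoffs to indicators and from
  simple functions to \<open>f\<close>, goes through this lemma.\<close>

lemma L2_polynomial_limit_dominated:
  fixes M :: "'a::euclidean_space measure"
  assumes sets: "sets M = sets borel" and g: "\<And>n::nat. L2_polynomial_limit M (g n)"
    and lim: "\<And>x. (\<lambda>n. g n x) \<longlonglongrightarrow> f x"
    and bound: "\<And>n x. cmod (g n x) \<le> B x" and [measurable]: "B \<in> borel_measurable M"
    and fin: "(\<integral>\<^sup>+x. ennreal ((B x)\<^sup>2) \<partial>M) < \<infinity>"
  shows "L2_polynomial_limit M f"
proof (rule L2_polynomial_limit_closed[OF sets])
  have [measurable]: "g n \<in> borel_measurable M" for n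
    using g by (auto simp: L2_polynomial_limit_def)
  show [measurable]: "f \<in> borel_measurable M"
    by (rule borel_measurable_LIMSEQ_metric[of g]) (auto simp: lim)
  have fB: "cmod (f x) \<le> B x" for x
    using tendsto_norm[OF lim] bound by (meson LIMSEQ_le_const2)
  have "(\<lambda>n. \<integral>\<^sup>+x. ennreal ((cmod (f x - g n x))\<^sup>2) \<partial>M) \<longlonglongrightarrow> (\<integral>\<^sup>+x. ennreal 0 \<partial>M)"
  proof (rule nn_integral_dominated_convergence)
    show "AE x in M. ennreal ((cmod (f x - g n x))\<^sup>2) \<le> ennreal (4 * (B x)\<^sup>2)" for n
    proof (rule AE_I2, rule ennreal_leI)
      fix x
      have "cmod (f x - g n x) \<le> 2 * B x"
        using norm_triangle_ineq4[of "f x" "g n x"] fB[of x] bound[of n x] by linarith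
      then have "(cmod (f x - g n x))\<^sup>2 \<le> (2 * B x)\<^sup>2" by (rule power_mono) simp
      then show "(cmod (f x - g n x))\<^sup>2 \<le> 4 * (B x)\<^sup>2"
        by (simp add: power2_eq_square)
    qed
    have "(\<integral>\<^sup>+x. ennreal (4 * (B x)\<^sup>2) \<partial>M) = 4 * (\<integral>\<^sup>+x. ennreal ((B x)\<^sup>2) \<partial>M)"
      by (subst nn_integral_cmult[symmetric]) (auto simp: ennreal_mult')
    also have "\<dots> < \<infinity>" using fin by (simp add: ennreal_mult_less_top)
    finally show "(\<integral>\<^sup>+x. ennreal (4 * (B x)\<^sup>2) \<partial>M) < \<infinity>" .
    show "AE x in M. (\<lambda>n. ennreal ((cmod (f x - g n x))\<^sup>2)) \<longlonglongrightarrow> ennreal 0"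
    proof (rule AE_I2)
      fix x
      have "(\<lambda>n. (cmod (f x - g n x))\<^sup>2) \<longlonglongrightarrow> (cmod (f x - f x))\<^sup>2"
        by (intro tendsto_intros lim)
      then have "(\<lambda>n. (cmod (f x - g n x))\<^sup>2) \<longlonglongrightarrow> 0" by simp
      then show "(\<lambda>n. ennreal ((cmod (f x - g n x))\<^sup>2)) \<longlonglongrightarrow> ennreal 0" by (rule tendsto_ennrealI)
    qed
  qed auto
  then have lim0: "(\<lambda>n. \<integral>\<^sup>+x. ennreal ((cmod (f x - g n x))\<^sup>2) \<partial>M) \<longlonglongrightarrow> 0" by simp
  fix e :: real assume "e > 0"
  then have "eventually (\<lambda>n. (\<integral>\<^sup>+x. ennreal ((cmod (f x - g n x))\<^sup>2) \<partial>M) < ennreal e) sequentially"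
    using order_tendstoD(2)[OF lim0, of "ennreal e"] by simp
  then show "\<exists>g. L2_polynomial_limit M g \<and> (\<integral>\<^sup>+x. (cmod (f x - g x))\<^sup>2 \<partial>M) < ennreal e"
    using g by (meson eventually_sequentially order_refl)
qed

lemma L2_polynomial_limit_continuous:
  fixes M :: "'a::euclidean_space measure"
  assumes sets: "sets M = sets borel" and "finite_measure M" and K: "compact K" "AE x in M. x \<in> K"
    and f: "continuous_on UNIV f"
  shows "L2_polynomial_limit M f"
  unfolding L2_polynomial_limit_def
proof (intro conjI allI impI)
  interpret finite_measure M by fact
  show [measurable]: "f \<in> borel_measurable M"
    using borel_measurable_continuous_onI[OF f] by (simp add: measurable_cong_sets[OF sets refl])
  fix e :: real assume "e > 0"
  \<comment> \<open>A uniform error below \<open>d\<close> on \<open>K\<close> contributes at most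
    \<open>d\<^sup>2\<close> times the total mass; with mass + 1 in the denominator this is below
    \<open>e\<close> even for the zero measure.\<close>
  define m where "m = measure M (space M) + 1"
  have m: "m > 0" by (simp add: m_def add_nonneg_pos)
  define d where "d = sqrt (e / m)"
  have "d > 0" using m \<open>e > 0\<close> by (simp add: d_def)
  then obtain p where p: "polynomial_function p" "\<And>x. x \<in> K \<Longrightarrow> norm (f x - p x) < d"
    using Stone_Weierstrass_polynomial_function[OF K(1), of f d] continuous_on_subset[OF f] by auto
  have "(\<integral>\<^sup>+x. (cmod (f x - p x))\<^sup>2 \<partial>M) \<le> (\<integral>\<^sup>+x. ennreal (d\<^sup>2) \<partial>M)"
    using K(2) by (intro nn_integral_mono_AE)
      (auto elim!: eventually_mono intro!: ennreal_leI power_mono less_imp_le[OF p(2)])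
  also have "\<dots> = ennreal (d\<^sup>2 * measure M (space M))"
    by (simp add: emeasure_eq_measure ennreal_mult')
  also have "\<dots> < ennreal e"
    using m \<open>e > 0\<close> by (simp add: d_def ennreal_less_iff field_simps m_def)
  finally show "\<exists>p. polynomial_function p \<and> (\<integral>\<^sup>+x. (cmod (f x - p x))\<^sup>2 \<partial>M) < ennreal e"
    using p by blast
qed

text \<open>Dynkin's \<pi>-\<lambda> argument with the closed sets as generator, since their
  indicators are bounded limits of continuous functions.\<close>

lemma L2_polynomial_limit_indicator:
  fixes M :: "'a::euclidean_space measure"
  assumes sets: "sets M = sets borel" and fin: "finite_measure M" and K: "compact K" "AE x in M. x \<in> K"
    and A: "A \<in> sets borel"
  shows "L2_polynomial_limit M (\<lambda>x. indicator A x)"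
proof -
  interpret finite_measure M by fact
  have fin1: "(\<integral>\<^sup>+x. ennreal (1\<^sup>2) \<partial>M) < \<infinity>"
    using emeasure_finite[of "space M"] by (simp add: less_top[symmetric] del: emeasure_finite)
  note cont = L2_polynomial_limit_continuous[OF sets fin K]
  show ?thesis
  proof (rule sigma_sets_induct_disjoint[of "Collect closed" UNIV A
        "\<lambda>A. L2_polynomial_limit M (\<lambda>x. indicator A x)"])
    show "A \<in> sigma_sets UNIV (Collect closed)"
      using A by (simp add: borel_eq_closed)
  next
    show "Int_stable (Collect closed :: 'a set set)" by (auto simp: Int_stable_def)
  next
    fix C :: "'a set" assume "C \<in> Collect closed"
    then have C: "closed C" by simp
    show "L2_polynomial_limit M (\<lambda>x. indicator C x)"
    \<comment> \<open>\<open>infdist x {}\<close> is 0, so the cutoffs used for nonempty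
      \<open>C\<close> would be constantly 1 here.\<close>
    proof (cases "C = {}")
      case True
      then show ?thesis using cont[of "\<lambda>x. 0"] by simp
    next
      case False
      show ?thesis
      proof (rule L2_polynomial_limit_dominated[OF sets _ _ _ _ fin1])
        \<comment> \<open>Lipschitz cutoffs equal to 1 on \<open>C\<close>. Off the closed set the
          distance is positive, so they vanish there once \<open>n\<close> is large.\<close>
        let ?g = "\<lambda>(n::nat) x. complex_of_real (max 0 (1 - real n * infdist x C))"
        show "L2_polynomial_limit M (?g n)" for n
          by (intro cont continuous_intros)
        show "cmod (?g n x) \<le> 1" for n x
          by (simp add: infdist_nonneg)
        show "(\<lambda>n. ?g n x) \<longlonglongrightarrow> indicator C x" for x
        proof (cases "x \<in> C")
          case True
          then show ?thesis by simp
        next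
          case notin: False
          then have pos: "infdist x C > 0"
            using C False infdist_nonneg[of x C] in_closed_iff_infdist_zero[OF C False] by force
          obtain n0 :: nat where n0: "real n0 * infdist x C > 1"
            using pos reals_Archimedean3 by blast
          have "?g n x = 0" if "n \<ge> n0" for n
          proof -
            have "real n * infdist x C \<ge> real n0 * infdist x C"
              using that pos by (intro mult_right_mono) auto
            then show ?thesis using n0 by simp
          qed
          then have "eventually (\<lambda>n. ?g n x = 0) sequentially"
            by (auto simp: eventually_sequentially)
          then show ?thesis using notin by (simp add: tendsto_eventually)
        qed
      qed auto
    qed
  next
    show "L2_polynomial_limit M (\<lambda>x. indicator {} x)"
      using cont[of "\<lambda>x. 0"] by simp
  next
    fix A :: "'a set" assume "A \<in> sigma_sets UNIV (Collect closed)" "L2_polynomial_limit M (\<lambda>x. indicator A x)"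
    then have "L2_polynomial_limit M (\<lambda>x. 1 + (-1) * indicator A x)"
      by (intro L2_polynomial_limit_add[OF sets cont] L2_polynomial_limit_cmult[OF sets]) auto
    moreover have "(\<lambda>x. 1 + (-1) * indicator A x) = (\<lambda>x. indicator (UNIV - A) x :: complex)"
      by (auto simp: indicator_def)
    ultimately show "L2_polynomial_limit M (\<lambda>x. indicator (UNIV - A) x)" by simp
  next
    fix A :: "nat \<Rightarrow> 'a set"
    assume disj: "disjoint_family A" and A: "\<And>i. L2_polynomial_limit M (\<lambda>x. indicator (A i) x)"
    \<comment> \<open>Disjointness makes the partial sums indicators again, which keeps them bounded
      by 1.\<close>
    have eq: "(\<Sum>i<n. indicator (A i) x) = (indicator (\<Union>i<n. A i) x :: complex)" for n x
      using disj by (intro indicator_UN_disjoint[symmetric])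
        (auto simp: disjoint_family_on_def)
    show "L2_polynomial_limit M (\<lambda>x. indicator (\<Union>i. A i) x)"
    proof (rule L2_polynomial_limit_dominated[OF sets _ _ _ _ fin1])
      show "L2_polynomial_limit M (\<lambda>x. \<Sum>i<n. indicator (A i) x)" for n
        by (intro L2_polynomial_limit_sum sets A) auto
      show "(\<lambda>n. \<Sum>i<n. indicator (A i) x) \<longlonglongrightarrow> (indicator (\<Union>i. A i) x :: complex)" for x
        unfolding eq by (rule LIMSEQ_indicator_UN)
      show "cmod (\<Sum>i<n. indicator (A i) x) \<le> 1" for n x
        unfolding eq by (simp add: indicator_def)
    qed auto
  qed auto
qed

text \<open>Simple functions converging to \<open>f\<close> under the bound
  \<open>2 * cmod (f x)\<close> reduce the claim to indicators; the square of this bound has finite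
  integral.\<close>

lemma L2_polynomial_dense:
  fixes M :: "'a::euclidean_space measure"
  assumes sets: "sets M = sets borel" and fin: "finite_measure M" and K: "compact K" "AE x in M. x \<in> K"
    and [measurable]: "f \<in> borel_measurable M" and f: "(\<integral>\<^sup>+x. ennreal ((cmod (f x))\<^sup>2) \<partial>M) < \<infinity>"
  shows "L2_polynomial_limit M f"
proof -
  have space: "space M = UNIV" using sets_eq_imp_space_eq[OF sets] by simp
  obtain F where F: "\<And>i. simple_function M (F i)" "\<And>x. (\<lambda>i. F i x) \<longlonglongrightarrow> f x"
     "\<And>i x. dist (F i x) 0 \<le> 2 * dist (f x) 0"
    using borel_measurable_implies_sequence_metric[OF assms(5), of 0] space by auto
  show ?thesis
  proof (rule L2_polynomial_limit_dominated[OF sets _ F(2)])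
    fix n
    have "F n x = (\<Sum>y\<in>range (F n). y * indicator (F n -` {y}) x)" for x
    proof -
      have "F n x = (\<Sum>y\<in>F n ` space M. indicator (F n -` {y} \<inter> space M) x *\<^sub>R y)"
        by (rule simple_function_indicator_representation_banach[OF F(1)]) (simp add: space)
      also have "\<dots> = (\<Sum>y\<in>range (F n). y * indicator (F n -` {y}) x)"
        by (intro sum.cong) (auto simp: indicator_def space)
      finally show ?thesis .
    qed
    then have *: "F n = (\<lambda>x. \<Sum>y\<in>range (F n). y * indicator (F n -` {y}) x)" by (rule ext)
    show "L2_polynomial_limit M (F n)"
      apply (subst *)
      using F(1)[of n] space
      by (intro L2_polynomial_limit_sum L2_polynomial_limit_cmult sets
          L2_polynomial_limit_indicator[OF sets fin K])
        (auto simp: simple_function_def sets)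
  next
    show "cmod (F n x) \<le> 2 * cmod (f x)" for n x using F(3)[of n x] by simp
    have "(\<integral>\<^sup>+x. ennreal ((2 * cmod (f x))\<^sup>2) \<partial>M) = 4 * (\<integral>\<^sup>+x. ennreal ((cmod (f x))\<^sup>2) \<partial>M)"
      by (subst nn_integral_cmult[symmetric]) (auto simp: ennreal_mult' power_mult_distrib)
    also have "\<dots> < \<infinity>" using f by (simp add: ennreal_mult_less_top)
    finally show "(\<integral>\<^sup>+x. ennreal ((2 * cmod (f x))\<^sup>2) \<partial>M) < \<infinity>" .
  qed auto
qed

subsection \<open>Parseval for Fourier series\<close>

lemma borel_measurable_cnj [measurable]: "cnj \<in> borel_measurable borel"
  by (intro borel_measurable_continuous_onI continuous_intros)

text \<open>Brings a \<open>has_sum\<close> into the form of an integral over a counting measure,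
  where Tonelli can exchange it with Lebesgue integrals.\<close>

lemma nn_integral_count_space_eq_has_sum:
  assumes "(f has_sum s) A" "\<And>x. x \<in> A \<Longrightarrow> f x \<ge> (0::real)"
  shows "(\<integral>\<^sup>+x. ennreal (f x) \<partial>count_space A) = ennreal s"
proof -
  have "Infinite_Set_Sum.abs_summable_on f A"
    using has_sum_imp_summable[OF assms(1)] summable_on_iff_abs_summable_on_real abs_summable_equivalent
    by blast
  then show ?thesis
    using nn_integral_conv_infsetsum[of f A] infsetsum_infsum[of f A] infsumI[OF assms(1)] assms(2)
    by simp
qed

section \<open>Parseval's identity for orthonormal systems of unimodular functions\<close>

context
  fixes M :: "'a measure" and e :: "'i \<Rightarrow> 'a \<Rightarrow> complex" and f :: "'a \<Rightarrow> complex"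
  assumes fin: "finite_measure M" and e [measurable]: "\<And>k. e k \<in> borel_measurable M"
    and norm_e: "\<And>k x. cmod (e k x) = 1"
    and orth: "\<And>k l. (LINT x|M. e k x * cnj (e l x)) = of_bool (k = l)"
    and f [measurable]: "f \<in> borel_measurable M" and sq_f: "integrable M (\<lambda>x. (cmod (f x))\<^sup>2)"
begin

text \<open>Expand the square and complete it around the Fourier coefficients \<open>c k\<close>.
  The coefficients \<open>a\<close> stay arbitrary because two choices matter: \<open>a = c\<close>
  gives Bessel's inequality, and those of a good approximation give the reverse estimate. As
  \<open>e k\<close> has modulus 1, all products are integrable by comparison with \<open>f\<close>
  or a constant.\<close>

lemma orthonormal_approximation_error:
  assumes "finite S"
  defines "c \<equiv> \<lambda>k. LINT x|M. f x * cnj (e k x)"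
  shows "integrable M (\<lambda>x. (cmod (f x - (\<Sum>k\<in>S. a k * e k x)))\<^sup>2)"
    and "(LINT x|M. (cmod (f x - (\<Sum>k\<in>S. a k * e k x)))\<^sup>2)
      = (LINT x|M. (cmod (f x))\<^sup>2) - (\<Sum>k\<in>S. (cmod (c k))\<^sup>2) + (\<Sum>k\<in>S. (cmod (c k - a k))\<^sup>2)"
proof -
  interpret finite_measure M by (rule fin)
  have int_f: "integrable M f"
  proof (rule Bochner_Integration.integrable_bound)
    show "integrable M (\<lambda>x. 1 + (cmod (f x))\<^sup>2)" using sq_f by simp
    have "cmod (f x) \<le> 1 + (cmod (f x))\<^sup>2" for x
      by (smt (verit) power2_eq_square mult_left_mono norm_ge_zero self_le_power zero_le_power2
          mult_le_cancel_left1 one_power2)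
    then have "cmod (f x) \<le> norm (1 + (cmod (f x))\<^sup>2)" for x
      by (smt (verit) real_norm_def)
    then show "AE x in M. cmod (f x) \<le> norm (1 + (cmod (f x))\<^sup>2)" by (rule AE_I2)
  qed auto
  have int_fe: "integrable M (\<lambda>x. f x * cnj (e k x))" for k
    by (rule Bochner_Integration.integrable_bound[OF int_f]) (auto simp: norm_mult norm_e)
  have int_ef: "integrable M (\<lambda>x. cnj (f x) * e k x)" for k
    by (rule Bochner_Integration.integrable_bound[OF int_f]) (auto simp: norm_mult norm_e)
  have int_ee: "integrable M (\<lambda>x. e k x * cnj (e l x))" for k l
    by (rule integrable_const_bound[of _ 1]) (auto simp: norm_mult norm_e)
  have int_ff: "integrable M (\<lambda>x. f x * cnj (f x))"
    using sq_f by (simp add: complex_norm_square[symmetric] complex_of_real_integrable_eq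
        flip: of_real_power)
  have c_cnj: "(LINT x|M. cnj (f x) * e k x) = cnj (c k)" for k
    unfolding c_def by (simp flip: Bochner_Integration.integral_cnj)
  let ?p = "\<lambda>x. \<Sum>k\<in>S. a k * e k x"
  have expand: "complex_of_real ((cmod (f x - ?p x))\<^sup>2) = f x * cnj (f x)
      - (\<Sum>k\<in>S. cnj (a k) * (f x * cnj (e k x))) - (\<Sum>k\<in>S. a k * (cnj (f x) * e k x))
      + (\<Sum>k\<in>S. \<Sum>l\<in>S. a k * cnj (a l) * (e k x * cnj (e l x)))" for x
    unfolding complex_norm_square
    by (simp add: algebra_simps sum_distrib_left sum_distrib_right sum_product) (rule sum.swap)
  have int: "integrable M (\<lambda>x. complex_of_real ((cmod (f x - ?p x))\<^sup>2))"
    unfolding expand using int_fe int_ef int_ee int_ff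
    by (intro Bochner_Integration.integrable_add Bochner_Integration.integrable_diff
        Bochner_Integration.integrable_sum integrable_mult_right) auto
  then show "integrable M (\<lambda>x. (cmod (f x - ?p x))\<^sup>2)"
    by (simp add: complex_of_real_integrable_eq del: of_real_power)
  have "complex_of_real (LINT x|M. (cmod (f x - ?p x))\<^sup>2)
      = (LINT x|M. complex_of_real ((cmod (f x - ?p x))\<^sup>2))"
    by (simp del: of_real_power)
  also have "\<dots> = (LINT x|M. f x * cnj (f x))
      - (\<Sum>k\<in>S. cnj (a k) * c k) - (\<Sum>k\<in>S. a k * cnj (c k))
      + (\<Sum>k\<in>S. \<Sum>l\<in>S. a k * cnj (a l) * of_bool (k = l))"
    unfolding expand by (simp add: int_fe int_ef int_ee int_ff c_cnj orth) (simp add: c_def)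
  also have "(\<Sum>k\<in>S. \<Sum>l\<in>S. a k * cnj (a l) * of_bool (k = l)) = (\<Sum>k\<in>S. a k * cnj (a k))"
    using \<open>finite S\<close> by (intro sum.cong refl) (simp add: of_bool_def if_distrib cong: if_cong)
  also have "(LINT x|M. f x * cnj (f x)) = complex_of_real (LINT x|M. (cmod (f x))\<^sup>2)"
    by (simp add: complex_norm_square[symmetric] flip: of_real_power)
  also have "complex_of_real (LINT x|M. (cmod (f x))\<^sup>2)
      - (\<Sum>k\<in>S. cnj (a k) * c k) - (\<Sum>k\<in>S. a k * cnj (c k)) + (\<Sum>k\<in>S. a k * cnj (a k))
      = complex_of_real ((LINT x|M. (cmod (f x))\<^sup>2) - (\<Sum>k\<in>S. (cmod (c k))\<^sup>2) + (\<Sum>k\<in>S. (cmod (c k - a k))\<^sup>2))"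
    by (simp add: complex_norm_square sum_subtractf sum.distrib algebra_simps del: of_real_power)
  finally show "(LINT x|M. (cmod (f x - ?p x))\<^sup>2)
      = (LINT x|M. (cmod (f x))\<^sup>2) - (\<Sum>k\<in>S. (cmod (c k))\<^sup>2) + (\<Sum>k\<in>S. (cmod (c k - a k))\<^sup>2)"
    unfolding of_real_eq_iff .
qed

text \<open>Bessel's inequality bounds every finite sum from above. An approximation over
  \<open>S\<close> with error below \<epsilon> is no better than the Fourier one, so the squared
  coefficients over any finite superset of \<open>S\<close> exceed the squared norm minus
  \<epsilon>.\<close>

lemma parseval_of_dense:
  assumes dense: "\<And>\<epsilon>. \<epsilon> > 0 \<Longrightarrow> \<exists>S a. finite S \<and>
    (\<integral>\<^sup>+x. ennreal ((cmod (f x - (\<Sum>k\<in>S. a k * e k x)))\<^sup>2) \<partial>M) < ennreal \<epsilon>"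
  shows "((\<lambda>k. (cmod (LINT x|M. f x * cnj (e k x)))\<^sup>2) has_sum (LINT x|M. (cmod (f x))\<^sup>2)) UNIV"
proof -
  let ?c = "\<lambda>k. LINT x|M. f x * cnj (e k x)"
  have bessel: "(\<Sum>k\<in>T. (cmod (?c k))\<^sup>2) \<le> (LINT x|M. (cmod (f x))\<^sup>2)" if "finite T" for T
  proof -
    have "0 \<le> (LINT x|M. (cmod (f x - (\<Sum>k\<in>T. ?c k * e k x)))\<^sup>2)" by simp
    then show ?thesis
      using orthonormal_approximation_error(2)[OF that, of ?c] by simp
  qed
  show ?thesis unfolding has_sum_def
  proof (rule tendstoI)
    fix \<epsilon> :: real assume "\<epsilon> > 0"
    obtain S a where S: "finite S"
      and "(\<integral>\<^sup>+x. ennreal ((cmod (f x - (\<Sum>k\<in>S. a k * e k x)))\<^sup>2) \<partial>M) < ennreal \<epsilon>"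
      using dense[OF \<open>\<epsilon> > 0\<close>] by blast
    then have "(LINT x|M. (cmod (f x - (\<Sum>k\<in>S. a k * e k x)))\<^sup>2) < \<epsilon>"
      using orthonormal_approximation_error(1)[OF S, of a]
      by (subst (asm) nn_integral_eq_integral) (auto simp: ennreal_less_iff)
    moreover have "(\<Sum>k\<in>S. (cmod (?c k - a k))\<^sup>2) \<ge> 0" by (simp add: sum_nonneg)
    ultimately have S_lower: "(\<Sum>k\<in>S. (cmod (?c k))\<^sup>2) > (LINT x|M. (cmod (f x))\<^sup>2) - \<epsilon>"
      using orthonormal_approximation_error(2)[OF S, of a] by linarith
    have "dist (\<Sum>k\<in>T. (cmod (?c k))\<^sup>2) (LINT x|M. (cmod (f x))\<^sup>2) < \<epsilon>" if "finite T" "S \<subseteq> T" for T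
      using bessel[OF that(1)] S_lower sum_mono2[OF that, of "\<lambda>k. (cmod (?c k))\<^sup>2"]
      by (simp add: dist_real_def abs_if)
    then show "\<forall>\<^sub>F T in finite_subsets_at_top UNIV.
        dist (\<Sum>k\<in>T. (cmod (?c k))\<^sup>2) (LINT x|M. (cmod (f x))\<^sup>2) < \<epsilon>"
      using S by (auto simp: eventually_finite_subsets_at_top)
  qed
qed

end

text \<open>An inductive presentation makes closure under products a rule induction, without
  bookkeeping of index sets; \<open>trig_poly_eq_sum\<close> returns to explicit sums.\<close>

inductive trig_poly :: "(real \<Rightarrow> complex) \<Rightarrow> bool"
  where
    basis: "trig_poly (\<lambda>\<theta>. cis (2 * pi * of_int k * \<theta>))"
  | cmult: "trig_poly p \<Longrightarrow> trig_poly (\<lambda>\<theta>. c * p \<theta>)"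
  | add: "trig_poly p \<Longrightarrow> trig_poly q \<Longrightarrow> trig_poly (\<lambda>\<theta>. p \<theta> + q \<theta>)"

lemma trig_poly_const: "trig_poly (\<lambda>\<theta>. c)"
  using trig_poly.cmult[OF trig_poly.basis[of 0], of c] by simp

lemma trig_poly_mult_basis:
  "trig_poly p \<Longrightarrow> trig_poly (\<lambda>\<theta>. cis (2 * pi * of_int k * \<theta>) * p \<theta>)"
proof (induction rule: trig_poly.induct)
  case (basis l)
  show ?case
    using trig_poly.basis[of "k + l"] by (simp add: cis_mult ring_distribs)
next
  case (cmult p c)
  show ?case using trig_poly.cmult[OF cmult.IH, of c] by (simp add: mult_ac)
next
  case (add p q)
  show ?case using trig_poly.add[OF add.IH] by (simp add: ring_distribs)
qed

lemma trig_poly_mult: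
  assumes "trig_poly p" "trig_poly q"
  shows "trig_poly (\<lambda>\<theta>. p \<theta> * q \<theta>)"
  using assms(1)
proof (induction rule: trig_poly.induct)
  case (basis l)
  show ?case by (rule trig_poly_mult_basis[OF assms(2)])
next
  case (cmult p c)
  show ?case using trig_poly.cmult[OF cmult.IH, of c] by (simp add: mult_ac)
next
  case (add p r)
  show ?case using trig_poly.add[OF add.IH] by (simp add: ring_distribs)
qed

text \<open>A real-linear functional of \<open>cis \<phi>\<close> combines cosine and sine, hence
  \<open>cis \<phi>\<close> and \<open>cis (- \<phi>)\<close> by Euler's formula; sums and products
  are handled by the closure rules.\<close>

lemma trig_poly_real_polynomial:
  "real_polynomial_function r \<Longrightarrow> trig_poly (\<lambda>\<theta>. complex_of_real (r (cis (2 * pi * \<theta>))))"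
proof (induction rule: real_polynomial_function.induct)
  case (linear r)
  interpret bounded_linear r by fact
  have "complex_of_real (r (cis \<phi>))
      = ((r 1 - \<i> * r \<i>) / 2) * cis \<phi> + ((r 1 + \<i> * r \<i>) / 2) * cis (- \<phi>)" for \<phi>
  proof -
    have "cis \<phi> = cos \<phi> *\<^sub>R 1 + sin \<phi> *\<^sub>R \<i>" by (simp add: complex_eq_iff)
    then have "r (cis \<phi>) = cos \<phi> * r 1 + sin \<phi> * r \<i>" by (simp only: add scale) simp
    then show ?thesis by (simp add: complex_eq_iff field_simps)
  qed
  then have "(\<lambda>\<theta>. complex_of_real (r (cis (2 * pi * \<theta>)))) = (\<lambda>\<theta>. ((r 1 - \<i> * r \<i>) / 2) * cis (2 * pi * of_int 1 * \<theta>)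
      + ((r 1 + \<i> * r \<i>) / 2) * cis (2 * pi * of_int (- 1) * \<theta>))"
    by simp
  then show ?case by (simp only:) (intro trig_poly.intros)
next
  case (const c)
  show ?case by (rule trig_poly_const)
next
  case (add r s)
  show ?case using trig_poly.add[OF add.IH] by simp
next
  case (mult r s)
  show ?case using trig_poly_mult[OF mult.IH] by simp
qed

lemma trig_poly_polynomial:
  fixes p :: "complex \<Rightarrow> complex"
  assumes "polynomial_function p"
  shows "trig_poly (\<lambda>\<theta>. p (cis (2 * pi * \<theta>)))"
proof -
  have "real_polynomial_function (\<lambda>z. Re (p z))" "real_polynomial_function (\<lambda>z. Im (p z))"
    using assms bounded_linear_Re bounded_linear_Im by (auto simp: polynomial_function_def o_def)
  then have "trig_poly (\<lambda>\<theta>. complex_of_real (Re (p (cis (2 * pi * \<theta>))))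
      + \<i> * complex_of_real (Im (p (cis (2 * pi * \<theta>)))))"
    by (intro trig_poly.add trig_poly.cmult trig_poly_real_polynomial)
  then show ?thesis by (simp add: complex_eq[symmetric])
qed

lemma trig_poly_eq_sum:
  "trig_poly p \<Longrightarrow> \<exists>S a. finite S \<and> (\<forall>\<theta>. p \<theta> = (\<Sum>k\<in>S. a k * cis (2 * pi * of_int k * \<theta>)))"
proof (induction rule: trig_poly.induct)
  case (basis k)
  show ?case by (intro exI[of _ "{k}"] exI[of _ "\<lambda>_. 1"]) simp
next
  case (cmult p c)
  then obtain S a where "finite S" "\<forall>\<theta>. p \<theta> = (\<Sum>k\<in>S. a k * cis (2 * pi * of_int k * \<theta>))"
    by blast
  then show ?case
    by (intro exI[of _ S] exI[of _ "\<lambda>k. c * a k"]) (simp add: sum_distrib_left mult_ac)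
next
  case (add p q)
  then obtain S a T b where S: "finite S" "\<forall>\<theta>. p \<theta> = (\<Sum>k\<in>S. a k * cis (2 * pi * of_int k * \<theta>))"
    and T: "finite T" "\<forall>\<theta>. q \<theta> = (\<Sum>k\<in>T. b k * cis (2 * pi * of_int k * \<theta>))"
    by blast
  have "(\<Sum>k\<in>S. a k * g k) = (\<Sum>k\<in>S \<union> T. (if k \<in> S then a k else 0) * g k)" 
       "(\<Sum>k\<in>T. b k * g k) = (\<Sum>k\<in>S \<union> T. (if k \<in> T then b k else 0) * g k)" for g
    using S(1) T(1) by (intro sum.mono_neutral_cong_left; auto)+
  then show ?case using S T
    by (intro exI[of _ "S \<union> T"] exI[of _ "\<lambda>k. (if k \<in> S then a k else 0) + (if k \<in> T then b k else 0)"])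
      (simp add: sum.distrib ring_distribs)
qed

lemma borel_measurable_Arg2pi [measurable]: "Arg2pi \<in> borel_measurable borel"
  unfolding borel_measurable_iff_greater using open_Arg2pi2pi_gt by simp

lemma Arg2pi_cis: "0 \<le> t \<Longrightarrow> t < 2 * pi \<Longrightarrow> Arg2pi (cis t) = t"
  by (rule Arg2pi_unique[of 1]) (auto simp: cis_conv_exp)

lemma borel_measurable_cis [measurable]: "cis \<in> borel_measurable borel"
  by (intro borel_measurable_continuous_onI continuous_intros)

abbreviation unit_interval_measure :: "real measure"
  where "unit_interval_measure \<equiv> restrict_space lborel {0..1}"

text \<open>The image \<open>C\<close> of Lebesgue measure under
  \<open>\<theta> \<mapsto> cis (2 * pi * \<theta>)\<close> is finite and carried by the compact
  unit circle, so polynomials are dense in its L2 space. Pulled back to the interval they become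
  trigonometric polynomials.\<close>

lemma trig_sum_dense:
  assumes [measurable]: "f \<in> borel_measurable borel"
    and fin: "(\<integral>\<^sup>+\<theta>. ennreal ((cmod (f \<theta>))\<^sup>2) \<partial>unit_interval_measure) < \<infinity>" and "\<epsilon> > 0"
  shows "\<exists>S a. finite S \<and> (\<integral>\<^sup>+\<theta>. ennreal ((cmod (f \<theta> -
    (\<Sum>k\<in>S. a k * cis (2 * pi * of_int k * \<theta>))))\<^sup>2) \<partial>unit_interval_measure) < ennreal \<epsilon>"
proof -
  let ?I = unit_interval_measure
  define C where "C = distr ?I borel (\<lambda>\<theta>. cis (2 * pi * \<theta>))"
  define F where "F z = f (Arg2pi z / (2 * pi))" for z
  have cis_meas [measurable]: "(\<lambda>\<theta>. cis (2 * pi * \<theta>)) \<in> borel_measurable ?I"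
    by (intro measurable_restrict_space1) simp
  have [measurable]: "f \<in> borel_measurable ?I" by (intro measurable_restrict_space1) simp
  have [measurable]: "F \<in> borel_measurable borel" unfolding F_def by measurable
  \<comment> \<open>At \<theta> = 1 the angle is read as 0, so \<open>F\<close> may disagree with
    \<open>f\<close> at this endpoint.\<close>
  have "AE \<theta> in lborel. \<theta> \<in> {0..1} \<longrightarrow> \<theta> \<noteq> (1::real)"
    using AE_lborel_singleton[of "1::real"] by (auto elim: eventually_mono)
  then have AE_I: "AE \<theta> in ?I. F (cis (2 * pi * \<theta>)) = f \<theta>"
    by (subst AE_restrict_space_iff) (auto elim!: eventually_mono simp: F_def Arg2pi_cis)
  have sets: "sets C = sets borel" by (simp add: C_def)
  have "emeasure ?I (space ?I) < \<infinity>"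
    by (simp add: space_restrict_space emeasure_restrict_space)
  then have "finite_measure ?I" by (intro finite_measureI) auto
  then have finC: "finite_measure C"
    unfolding C_def by (intro finite_measure.finite_measure_distr) auto
  have K: "AE z in C. z \<in> sphere 0 1"
    unfolding C_def by (subst AE_distr_iff) auto
  have "(\<integral>\<^sup>+z. ennreal ((cmod (F z))\<^sup>2) \<partial>C) = (\<integral>\<^sup>+\<theta>. ennreal ((cmod (f \<theta>))\<^sup>2) \<partial>?I)"
    unfolding C_def using AE_I
    by (subst nn_integral_distr) (auto intro!: nn_integral_cong_AE)
  then have "L2_polynomial_limit C F"
    using fin by (intro L2_polynomial_dense[OF sets finC _ K]) (auto simp: C_def)
  then obtain p where p: "polynomial_function p" "(\<integral>\<^sup>+z. (cmod (F z - p z))\<^sup>2 \<partial>C) < ennreal \<epsilon>"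
    using \<open>\<epsilon> > 0\<close> unfolding L2_polynomial_limit_def by blast
  have [measurable]: "p \<in> borel_measurable borel"
    using polynomial_function_borel_measurable[OF p(1)] by simp
  obtain S a where S: "finite S" "\<And>\<theta>. p (cis (2 * pi * \<theta>)) = (\<Sum>k\<in>S. a k * cis (2 * pi * of_int k * \<theta>))"
    using trig_poly_eq_sum[OF trig_poly_polynomial[OF p(1)]] by blast
  have "(\<integral>\<^sup>+z. (cmod (F z - p z))\<^sup>2 \<partial>C) = (\<integral>\<^sup>+\<theta>. ennreal ((cmod (f \<theta> -
      (\<Sum>k\<in>S. a k * cis (2 * pi * of_int k * \<theta>))))\<^sup>2) \<partial>?I)"
    unfolding C_def using AE_I
    by (subst nn_integral_distr) (auto intro!: nn_integral_cong_AE simp: S(2))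
  with p(2) have "(\<integral>\<^sup>+\<theta>. ennreal ((cmod (f \<theta> -
      (\<Sum>k\<in>S. a k * cis (2 * pi * of_int k * \<theta>))))\<^sup>2) \<partial>?I) < ennreal \<epsilon>"
    by (simp only:)
  then show ?thesis using S(1) by blast
qed

lemma integral_cis_unit_interval:
  "(LINT \<theta>|unit_interval_measure. cis (2 * pi * of_int k * \<theta>)) = of_bool (k = 0)"
proof (cases "k = 0")
  case True
  then show ?thesis by (simp add: measure_restrict_space)
next
  case False
  let ?F = "\<lambda>\<theta>::real. cis (2 * pi * of_int k * \<theta>) / (2 * pi * of_int k * \<i>)"
  have "(LINT \<theta>|unit_interval_measure. cis (2 * pi * of_int k * \<theta>))
      = (LINT \<theta>|lborel. indicator {0..1} \<theta> *\<^sub>R cis (2 * pi * of_int k * \<theta>))"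
    by (subst integral_restrict_space) auto
  also have "\<dots> = ?F 1 - ?F 0"
  proof (rule integral_FTC_atLeastAtMost)
    show "(?F has_vector_derivative cis (2 * pi * of_int k * \<theta>)) (at \<theta> within {0..1})" for \<theta>
      using False by (auto intro!: derivative_eq_intros simp: has_vector_derivative_def
          fun_eq_iff scaleR_conv_of_real field_simps)
    show "continuous_on {0..1} (\<lambda>\<theta>. cis (2 * pi * of_int k * \<theta>))"
      by (intro continuous_intros)
  qed auto
  also have "cis (2 * pi * of_int k * 1) = 1"
    using cis_multiple_2pi[of "of_int k"] by (simp add: mult_ac)
  finally show ?thesis using False by simp
qed

lemma parseval_unit_interval:
  assumes [measurable]: "f \<in> borel_measurable borel"
    and fin: "(\<integral>\<^sup>+\<theta>. ennreal ((cmod (f \<theta>))\<^sup>2) \<partial>unit_interval_measure) < \<infinity>"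
  shows "(\<integral>\<^sup>+k. ennreal ((cmod (LINT \<theta>|unit_interval_measure. f \<theta> * cis (- (2 * pi * of_int k * \<theta>))))\<^sup>2)
    \<partial>count_space UNIV) = (\<integral>\<^sup>+\<theta>. ennreal ((cmod (f \<theta>))\<^sup>2) \<partial>unit_interval_measure)"
proof -
  let ?I = unit_interval_measure
  have meas [measurable]: "g \<in> borel_measurable ?I" if "g \<in> borel_measurable borel" for g :: "real \<Rightarrow> complex"
    using that by (intro measurable_restrict_space1) simp
  have "emeasure ?I (space ?I) < \<infinity>"
    by (simp add: space_restrict_space emeasure_restrict_space)
  then have finI: "finite_measure ?I" by (intro finite_measureI) auto
  have int: "integrable ?I (\<lambda>\<theta>. (cmod (f \<theta>))\<^sup>2)"
    using fin by (intro integrableI_nonneg) (auto simp: less_top intro: measurable_compose[OF meas[OF assms(1)]])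
  have "((\<lambda>k. (cmod (LINT \<theta>|?I. f \<theta> * cnj (cis (2 * pi * of_int k * \<theta>))))\<^sup>2) has_sum
      (LINT \<theta>|?I. (cmod (f \<theta>))\<^sup>2)) UNIV"
  proof (rule parseval_of_dense[OF finI])
    show "(LINT \<theta>|?I. cis (2 * pi * of_int k * \<theta>) * cnj (cis (2 * pi * of_int l * \<theta>))) = of_bool (k = l)"
      for k l
      using integral_cis_unit_interval[of "k - l"]
      by (simp add: cis_cnj cis_mult left_diff_distrib right_diff_distrib)
  qed (use int trig_sum_dense[OF assms] in auto)
  from nn_integral_count_space_eq_has_sum[OF this] show ?thesis
    by (simp add: cis_cnj nn_integral_eq_integral[OF int])
qed

text \<open>Substitute \<open>x = a + P * \<theta>\<close>. The offset \<open>a\<close> becomes a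
  phase that the modulus removes, and \<open>k \<mapsto> - k\<close> reverses the sign in the
  exponential. Squared coefficients scale by \<open>P\<^sup>2\<close> and the squared norm by
  \<open>P\<close>, which leaves one factor \<open>P\<close>.\<close>

lemma parseval_interval:
  assumes [measurable]: "f \<in> borel_measurable borel" and "P > 0"
    and fin: "(\<integral>\<^sup>+x\<in>{a..a+P}. ennreal ((cmod (f x))\<^sup>2) \<partial>lborel) < \<infinity>"
  shows "(\<integral>\<^sup>+k. ennreal ((cmod (LINT x:{a..a+P}|lborel. f x * cis (2 * pi * of_int k * x / P)))\<^sup>2)
    \<partial>count_space UNIV) = ennreal P * (\<integral>\<^sup>+x\<in>{a..a+P}. ennreal ((cmod (f x))\<^sup>2) \<partial>lborel)"
proof -
  let ?I = unit_interval_measure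
  define g where "g \<theta> = f (a + P * \<theta>)" for \<theta>
  have [measurable]: "g \<in> borel_measurable borel" unfolding g_def by measurable
  have ind: "indicator {a..a+P} (a + P * \<theta>) = (indicator {0..1} \<theta> :: 'z::zero_neq_one)" for \<theta>
    using \<open>P > 0\<close> by (auto simp: indicator_def mult_le_cancel_left1 zero_le_mult_iff)
  have nn: "(\<integral>\<^sup>+x\<in>{a..a+P}. ennreal ((cmod (f x))\<^sup>2) \<partial>lborel)
      = ennreal P * (\<integral>\<^sup>+\<theta>. ennreal ((cmod (g \<theta>))\<^sup>2) \<partial>?I)"
    using \<open>P > 0\<close>
    by (subst nn_integral_real_affine[of _ P a]) (auto simp: ind nn_integral_restrict_space g_def)
  have "ennreal P * (\<integral>\<^sup>+\<theta>. ennreal ((cmod (g \<theta>))\<^sup>2) \<partial>?I) < \<infinity>"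
    using fin nn by simp
  then have fin_g: "(\<integral>\<^sup>+\<theta>. ennreal ((cmod (g \<theta>))\<^sup>2) \<partial>?I) < \<infinity>"
    using \<open>P > 0\<close> by (auto simp: ennreal_mult_less_top)
  have coeff: "cmod (LINT x:{a..a+P}|lborel. f x * cis (2 * pi * of_int k * x / P))
      = P * cmod (LINT \<theta>|?I. g \<theta> * cis (- (2 * pi * of_int (- k) * \<theta>)))" for k
  proof -
    have "(LINT x:{a..a+P}|lborel. f x * cis (2 * pi * of_int k * x / P))
        = P *\<^sub>R (LINT \<theta>|lborel. indicator {0..1} \<theta> *\<^sub>R (g \<theta> * cis (2 * pi * of_int k * (a + P * \<theta>) / P)))"
      unfolding set_lebesgue_integral_def using \<open>P > 0\<close>
      by (subst lborel_integral_real_affine[of P _ a]) (auto simp: ind g_def)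
    also have "(\<lambda>\<theta>. indicator {0..1} \<theta> *\<^sub>R (g \<theta> * cis (2 * pi * of_int k * (a + P * \<theta>) / P)))
      = (\<lambda>\<theta>. cis (2 * pi * of_int k * a / P) * (indicator {0..1} \<theta> *\<^sub>R (g \<theta> * cis (- (2 * pi * of_int (- k) * \<theta>)))))"
    proof
      fix \<theta>
      have "cis (2 * pi * of_int k * (a + P * \<theta>) / P) = cis (2 * pi * of_int k * a / P) * cis (- (2 * pi * of_int (- k) * \<theta>))"
        using \<open>P > 0\<close> by (simp add: cis_mult field_simps)
      then show "indicator {0..1} \<theta> *\<^sub>R (g \<theta> * cis (2 * pi * of_int k * (a + P * \<theta>) / P))
        = cis (2 * pi * of_int k * a / P) * (indicator {0..1} \<theta> *\<^sub>R (g \<theta> * cis (- (2 * pi * of_int (- k) * \<theta>))))"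
        by (simp add: mult_ac)
    qed
    also have "(LINT \<theta>|lborel. cis (2 * pi * of_int k * a / P) * (indicator {0..1} \<theta> *\<^sub>R (g \<theta> * cis (- (2 * pi * of_int (- k) * \<theta>)))))
       = cis (2 * pi * of_int k * a / P) * (LINT \<theta>|?I. g \<theta> * cis (- (2 * pi * of_int (- k) * \<theta>)))"
      by (simp only: integral_mult_right_zero) (subst integral_restrict_space; simp)
    finally show ?thesis using \<open>P > 0\<close> by (simp add: norm_mult)
  qed
  have "(\<integral>\<^sup>+k. ennreal ((cmod (LINT x:{a..a+P}|lborel. f x * cis (2 * pi * of_int k * x / P)))\<^sup>2) \<partial>count_space UNIV)
      = (\<integral>\<^sup>+k. ennreal (P\<^sup>2) * ennreal ((cmod (LINT \<theta>|?I. g \<theta> * cis (- (2 * pi * of_int (- k) * \<theta>))))\<^sup>2) \<partial>count_space UNIV)"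
    unfolding coeff by (simp add: power_mult_distrib ennreal_mult')
  also have "\<dots> = ennreal (P\<^sup>2) * (\<integral>\<^sup>+k. ennreal ((cmod (LINT \<theta>|?I. g \<theta> * cis (- (2 * pi * of_int (- k) * \<theta>))))\<^sup>2) \<partial>count_space UNIV)"
    by (rule nn_integral_cmult) simp
  also have "(\<integral>\<^sup>+k. ennreal ((cmod (LINT \<theta>|?I. g \<theta> * cis (- (2 * pi * of_int (- k) * \<theta>))))\<^sup>2) \<partial>count_space UNIV)
      = (\<integral>\<^sup>+k. ennreal ((cmod (LINT \<theta>|?I. g \<theta> * cis (- (2 * pi * of_int k * \<theta>))))\<^sup>2) \<partial>count_space UNIV)"
    by (rule nn_integral_bij_count_space[of "uminus :: int \<Rightarrow> int"]) (rule bij_uminus)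
  also have "\<dots> = (\<integral>\<^sup>+\<theta>. ennreal ((cmod (g \<theta>))\<^sup>2) \<partial>?I)"
    using fin_g by (intro parseval_unit_interval) auto
  also have "ennreal (P\<^sup>2) * \<dots> = ennreal P * (ennreal P * \<dots>)"
    using \<open>P > 0\<close> by (simp add: power2_eq_square ennreal_mult' mult.assoc)
  finally show ?thesis unfolding nn .
qed

subsection \<open>Plancherel for the \<open>L\<^sup>2\<close> Fourier transform\<close>

lemma nn_integral_count_space_swap:
  fixes f :: "'a \<Rightarrow> 'i::countable \<Rightarrow> ennreal"
  assumes "sigma_finite_measure M" and "\<And>i. (\<lambda>x. f x i) \<in> borel_measurable M"
  shows "(\<integral>\<^sup>+x. (\<integral>\<^sup>+i. f x i \<partial>count_space UNIV) \<partial>M)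
    = (\<integral>\<^sup>+i. (\<integral>\<^sup>+x. f x i \<partial>M) \<partial>count_space UNIV)"
proof -
  interpret M: sigma_finite_measure M by fact
  interpret C: sigma_finite_measure "count_space (UNIV :: 'i set)"
    by (rule sigma_finite_measure_count_space)
  interpret pair_sigma_finite "count_space (UNIV :: 'i set)" M ..
  have "(\<lambda>(i, x). f x i) \<in> borel_measurable (count_space UNIV \<Otimes>\<^sub>M M)"
    by (rule measurable_pair_measure_countable1) (use assms(2) in auto)
  then show ?thesis using Fubini'[of "\<lambda>i x. f x i"] by simp
qed

lemma borel_measurable_nn_integral_count_space:
  fixes f :: "'a \<Rightarrow> 'i::countable \<Rightarrow> ennreal"
  assumes "\<And>i. (\<lambda>x. f x i) \<in> borel_measurable M"
  shows "(\<lambda>x. \<integral>\<^sup>+i. f x i \<partial>count_space UNIV) \<in> borel_measurable M"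
proof -
  interpret C: sigma_finite_measure "count_space (UNIV :: 'i set)"
    by (rule sigma_finite_measure_count_space)
  have "(\<lambda>(i, x). f x i) \<in> borel_measurable (count_space UNIV \<Otimes>\<^sub>M M)"
    by (rule measurable_pair_measure_countable1) (use assms in auto)
  then have "(\<lambda>(x, i). f x i) \<in> borel_measurable (M \<Otimes>\<^sub>M count_space UNIV)"
    using measurable_pair_swap[of "\<lambda>(i, x). f x i"] by (simp add: split_beta')
  then show ?thesis by (rule C.borel_measurable_nn_integral)
qed

text \<open>The translates of \<open>{0..<T}\<close> by multiples of \<open>T\<close> tile the line:
  the index of the tile containing \<open>x\<close> is \<lfloor>x / T\<rfloor>. Tonelli and
  translation invariance do the rest.\<close>

lemma nn_integral_lborel_periodize:
  fixes g :: "real \<Rightarrow> ennreal"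
  assumes [measurable]: "g \<in> borel_measurable borel" and "T > 0"
  shows "(\<integral>\<^sup>+x. g x \<partial>lborel)
    = (\<integral>\<^sup>+x\<in>{0..<T}. (\<integral>\<^sup>+n. g (x + of_int n * T) \<partial>count_space (UNIV :: int set)) \<partial>lborel)"
proof -
  have sf: "sigma_finite_measure (lborel :: real measure)" by unfold_locales
  have cover: "(\<integral>\<^sup>+n. indicator {0..<T} (x - of_int n * T) \<partial>count_space (UNIV :: int set)) = (1::ennreal)" for x
  proof -
    have iff: "indicator {0..<T} (x - of_int n * T) = (indicator {\<lfloor>x / T\<rfloor>} n :: ennreal)" for n :: int
    proof -
      have "n = \<lfloor>x / T\<rfloor> \<longleftrightarrow> of_int n \<le> x / T \<and> x / T < of_int n + 1"
        by linarith
      also have "\<dots> \<longleftrightarrow> 0 \<le> x - of_int n * T \<and> x - of_int n * T < T"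
        using \<open>T > 0\<close> by (auto simp: field_simps)
      finally show ?thesis by (auto simp: indicator_def)
    qed
    show ?thesis unfolding iff by simp
  qed
  have "(\<integral>\<^sup>+x\<in>{0..<T}. (\<integral>\<^sup>+n. g (x + of_int n * T) \<partial>count_space (UNIV :: int set)) \<partial>lborel)
      = (\<integral>\<^sup>+x. (\<integral>\<^sup>+n. g (x + of_int n * T) * indicator {0..<T} x \<partial>count_space (UNIV :: int set)) \<partial>lborel)"
    by (simp add: nn_integral_multc)
  also have "\<dots> = (\<integral>\<^sup>+n. (\<integral>\<^sup>+x. g (x + of_int n * T) * indicator {0..<T} x \<partial>lborel) \<partial>count_space (UNIV :: int set))"
    by (rule nn_integral_count_space_swap[OF sf]) measurable
  also have "\<dots> = (\<integral>\<^sup>+n. (\<integral>\<^sup>+x. g x * indicator {0..<T} (x - of_int n * T) \<partial>lborel) \<partial>count_space (UNIV :: int set))"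
  proof (rule nn_integral_cong)
    fix n :: int
    show "(\<integral>\<^sup>+x. g (x + of_int n * T) * indicator {0..<T} x \<partial>lborel)
        = (\<integral>\<^sup>+x. g x * indicator {0..<T} (x - of_int n * T) \<partial>lborel)"
      by (subst nn_integral_real_affine[of _ 1 "- (of_int n * T)"]) (auto simp: algebra_simps)
  qed
  also have "\<dots> = (\<integral>\<^sup>+x. (\<integral>\<^sup>+n. g x * indicator {0..<T} (x - of_int n * T) \<partial>count_space (UNIV :: int set)) \<partial>lborel)"
    by (rule nn_integral_count_space_swap[OF sf, symmetric]) measurable
  also have "\<dots> = (\<integral>\<^sup>+x. g x \<partial>lborel)"
    by (simp add: nn_integral_cmult cover)
  finally show ?thesis by simp
qed

lemma exp_eq_cis: "exp (2 * of_real pi * \<i> * of_real x * of_real \<nu>) = cis (2 * pi * x * \<nu>)"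
  "exp (- 2 * of_real pi * \<i> * of_real x * of_real \<nu>) = cis (- (2 * pi * x * \<nu>))"
  by (simp_all add: cis_conv_exp mult_ac)

lemma L2_nn_integral_finite:
  "f \<in> L2 M \<Longrightarrow> (\<integral>\<^sup>+x. ennreal ((cmod (f x))\<^sup>2) \<partial>M) < \<infinity>"
  by (auto simp: L2_def nn_integral_eq_integral)

lemma L2_norm_nn_integral:
  assumes "f \<in> L2 M"
  shows "ennreal ((L2_norm M f)\<^sup>2) = (\<integral>\<^sup>+x. ennreal ((cmod (f x))\<^sup>2) \<partial>M)"
  using assms by (simp add: L2_def L2_norm_def nn_integral_eq_integral)

text \<open>The approximant inside \<open>has_L2_fourier\<close>, with its exponential written as
  \<open>cis\<close>.\<close>

definition truncated_fourier :: "(real \<Rightarrow> complex) \<Rightarrow> real \<Rightarrow> real \<Rightarrow> complex"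
  where "truncated_fourier f R \<nu> = (LINT x:{-R..R}|lborel. f x * cis (- (2 * pi * x * \<nu>)))"

lemma borel_measurable_truncated_fourier [measurable]:
  assumes [measurable]: "f \<in> borel_measurable borel"
  shows "truncated_fourier f R \<in> borel_measurable borel"
  unfolding truncated_fourier_def set_lebesgue_integral_def
  by measurable

text \<open>With \<open>P = 2 * R\<close>, the values at the frequencies
  \<open>\<theta> + n / P\<close> are the Fourier coefficients on \<open>{-R..R}\<close> of
  \<open>f\<close> times a unimodular factor. Their squares therefore sum to \<open>P * ?A\<close>
  for every \<theta>, and integrating over a period of length \<open>1 / P\<close> cancels
  \<open>P\<close>.\<close>

lemma plancherel_truncated:
  assumes f: "f \<in> L2 lborel" and "R > 0"
  shows "(\<integral>\<^sup>+\<nu>. ennreal ((cmod (truncated_fourier f R \<nu>))\<^sup>2) \<partial>lborel)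
    = (\<integral>\<^sup>+x\<in>{-R..R}. ennreal ((cmod (f x))\<^sup>2) \<partial>lborel)" (is "_ = ?A")
proof -
  have [measurable]: "f \<in> borel_measurable borel" using f by (simp add: L2_def)
  define P where "P = 2 * R"
  have "P > 0" using \<open>R > 0\<close> by (simp add: P_def)
  have R: "-R + P = R" "P - R = R" by (simp_all add: P_def)
  have "?A \<le> (\<integral>\<^sup>+x. ennreal ((cmod (f x))\<^sup>2) \<partial>lborel)"
    by (intro nn_integral_mono) (auto simp: indicator_def)
  then have "?A < \<infinity>" using L2_nn_integral_finite[OF f] by (rule le_less_trans)
  have inner: "(\<integral>\<^sup>+n. ennreal ((cmod (truncated_fourier f R (\<theta> + of_int n * (1/P))))\<^sup>2) \<partial>count_space (UNIV :: int set))
      = ennreal P * ?A" for \<theta>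
  proof -
    define g where "g x = f x * cis (- (2 * pi * x * \<theta>))" for x
    have [measurable]: "g \<in> borel_measurable borel" unfolding g_def by measurable
    have norm_g: "cmod (g x) = cmod (f x)" for x by (simp add: g_def norm_mult)
    have "truncated_fourier f R (\<theta> + of_int n * (1/P))
        = (LINT x:{-R..-R+P}|lborel. g x * cis (2 * pi * of_int (- n) * x / P))" for n
    proof -
      have "cis (- (2 * pi * x * (\<theta> + of_int n * (1/P)))) 
          = cis (- (2 * pi * x * \<theta>)) * cis (2 * pi * of_int (- n) * x / P)" for x
        by (simp add: cis_mult algebra_simps add_divide_distrib)
      then show ?thesis
        unfolding truncated_fourier_def R(1) g_def by (simp only: mult.assoc)
    qed
    then have "(\<integral>\<^sup>+n. ennreal ((cmod (truncated_fourier f R (\<theta> + of_int n * (1/P))))\<^sup>2) \<partial>count_space (UNIV :: int set))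
      = (\<integral>\<^sup>+n. ennreal ((cmod (LINT x:{-R..-R+P}|lborel. g x * cis (2 * pi * of_int (- n) * x / P)))\<^sup>2) \<partial>count_space UNIV)"
      by (simp only:)
    also have "\<dots> = (\<integral>\<^sup>+n. ennreal ((cmod (LINT x:{-R..-R+P}|lborel. g x * cis (2 * pi * of_int n * x / P)))\<^sup>2) \<partial>count_space UNIV)"
      by (rule nn_integral_bij_count_space[of "uminus :: int \<Rightarrow> int"]) (rule bij_uminus)
    also have "\<dots> = ennreal P * (\<integral>\<^sup>+x\<in>{-R..-R+P}. ennreal ((cmod (g x))\<^sup>2) \<partial>lborel)"
      using \<open>?A < \<infinity>\<close> \<open>P > 0\<close> by (intro parseval_interval) (simp_all add: norm_g R)
    finally show ?thesis by (simp add: norm_g R)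
  qed
  have "(\<integral>\<^sup>+\<nu>. ennreal ((cmod (truncated_fourier f R \<nu>))\<^sup>2) \<partial>lborel)
      = (\<integral>\<^sup>+\<theta>\<in>{0..<1/P}. (\<integral>\<^sup>+n. ennreal ((cmod (truncated_fourier f R (\<theta> + of_int n * (1/P))))\<^sup>2)
          \<partial>count_space (UNIV :: int set)) \<partial>lborel)"
    using \<open>P > 0\<close> by (intro nn_integral_lborel_periodize) auto
  also have "\<dots> = ennreal P * ?A * ennreal (1 / P)"
    using \<open>P > 0\<close> unfolding inner by (subst nn_integral_cmult_indicator) auto
  also have "\<dots> = ?A * ennreal (P * (1 / P))"
    using \<open>P > 0\<close> by (subst ennreal_mult'') (auto simp: mult_ac)
  also have "\<dots> = ?A" using \<open>P > 0\<close> by simp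
  finally show ?thesis .
qed

text \<open>The mixed term is absorbed by expanding the square of \<open>\<delta> * a - b\<close>.
  Unlike the factor 2 used for density, the weight of the main term tends to 1 with \<delta>, which
  is what yields an equality of norms.\<close>

lemma cmod_square_weighted_le:
  assumes "\<delta> > 0"
  shows "(cmod x)\<^sup>2 \<le> (1 + \<delta>) * (cmod y)\<^sup>2 + (1 + 1 / \<delta>) * (cmod (x - y))\<^sup>2"
proof -
  define a b where "a = cmod y" and "b = cmod (x - y)"
  have "cmod x \<le> a + b"
    using norm_triangle_ineq[of y "x - y"] by (simp add: a_def b_def)
  then have "(cmod x)\<^sup>2 \<le> (a + b)\<^sup>2" by (simp add: power_mono)
  also have "\<dots> \<le> (1 + \<delta>) * a\<^sup>2 + (1 + 1 / \<delta>) * b\<^sup>2"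
  proof -
    have "0 \<le> (\<delta> * a - b)\<^sup>2 / \<delta>" using assms by simp
    also have "\<dots> = \<delta> * a\<^sup>2 - 2 * a * b + b\<^sup>2 / \<delta>"
      using assms by (simp add: field_simps power2_eq_square)
    finally show ?thesis by (simp add: power2_sum algebra_simps)
  qed
  finally show ?thesis by (simp add: a_def b_def)
qed

lemma nn_integral_cmod_square_weighted_le:
  assumes [measurable]: "f \<in> borel_measurable M" "g \<in> borel_measurable M" and "\<delta> > 0"
  shows "(\<integral>\<^sup>+x. (cmod (f x))\<^sup>2 \<partial>M)
    \<le> ennreal (1 + \<delta>) * (\<integral>\<^sup>+x. (cmod (g x))\<^sup>2 \<partial>M) + ennreal (1 + 1 / \<delta>) * (\<integral>\<^sup>+x. (cmod (f x - g x))\<^sup>2 \<partial>M)"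
proof -
  have "(\<integral>\<^sup>+x. (cmod (f x))\<^sup>2 \<partial>M)
    \<le> (\<integral>\<^sup>+x. ennreal (1 + \<delta>) * ennreal ((cmod (g x))\<^sup>2) + ennreal (1 + 1 / \<delta>) * ennreal ((cmod (f x - g x))\<^sup>2) \<partial>M)"
    using cmod_square_weighted_le[OF assms(3)] assms(3)
    by (intro nn_integral_mono) (simp flip: ennreal_plus ennreal_mult')
  also have "\<dots> = ennreal (1 + \<delta>) * (\<integral>\<^sup>+x. (cmod (g x))\<^sup>2 \<partial>M) + ennreal (1 + 1 / \<delta>) * (\<integral>\<^sup>+x. (cmod (f x - g x))\<^sup>2 \<partial>M)"
    by (simp add: nn_integral_add nn_integral_cmult)
  finally show ?thesis .
qed

lemma ennreal_le_of_le_weighted: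
  assumes "\<And>\<delta>. \<delta> > 0 \<Longrightarrow> a \<le> ennreal (1 + \<delta>) * b" and "b < \<infinity>"
  shows "a \<le> b"
proof -
  obtain r where r: "b = ennreal r" "r \<ge> 0" using assms(2) by (cases b) auto
  have "a \<le> ennreal (1 + 1) * b" using assms(1)[of 1] by simp
  also have "\<dots> < \<infinity>" unfolding r by (simp add: ennreal_mult_less_top)
  finally obtain s where s: "a = ennreal s" "s \<ge> 0" by (cases a) auto
  have "s \<le> r"
  proof (rule field_le_epsilon)
    fix e :: real assume "e > 0"
    \<comment> \<open>For \<delta> = \<open>e / (r + 1)\<close> the excess \<delta> \<open>r\<close>
      is at most \<open>e\<close>, also when \<open>r = 0\<close>.\<close>
    then have "ennreal s \<le> ennreal ((1 + e / (r + 1)) * r)"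
      using assms(1)[of "e / (r + 1)"] r s(1) unfolding ennreal_mult''[OF r(2)] by simp
    then have "s \<le> (1 + e / (r + 1)) * r"
      using \<open>e > 0\<close> r(2) by (simp add: ennreal_le_iff)
    also have "\<dots> \<le> r + e" using \<open>e > 0\<close> r(2) by (simp add: field_simps)
    finally show "s \<le> r + e" .
  qed
  then show ?thesis using r s by (simp add: ennreal_leI)
qed

lemma has_L2_fourier_sequentially:
  assumes "has_L2_fourier f g"
  shows "(\<lambda>n. \<integral>\<^sup>+\<nu>. ennreal ((cmod (g \<nu> - truncated_fourier f (real n) \<nu>))\<^sup>2) \<partial>lborel) \<longlonglongrightarrow> 0"
  using filterlim_compose[OF conjunct2[OF conjunct2[OF assms[unfolded has_L2_fourier_def]]] filterlim_real_sequentially]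
  by (simp only: exp_eq_cis truncated_fourier_def)

text \<open>The truncated norms \<open>A n\<close> tend to \<open>?F\<close>, and the distances
  \<open>D n\<close> to \<open>g\<close> tend to 0. For fixed \<delta>, letting \<open>n\<close>
  grow in the weighted inequality gives each estimate up to the factor 1 + \<delta>, which is then
  removed.\<close>

lemma plancherel:
  assumes "has_L2_fourier f g"
  shows "(\<integral>\<^sup>+\<nu>. ennreal ((cmod (g \<nu>))\<^sup>2) \<partial>lborel) = (\<integral>\<^sup>+x. ennreal ((cmod (f x))\<^sup>2) \<partial>lborel)"
    (is "?G = ?F")
proof -
  have f: "f \<in> L2 lborel" and g: "g \<in> L2 lborel"
    using assms by (auto simp: has_L2_fourier_def)
  have [measurable]: "f \<in> borel_measurable borel" "g \<in> borel_measurable borel"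
    using f g by (auto simp: L2_def)
  define D where "D n = (\<integral>\<^sup>+\<nu>. ennreal ((cmod (g \<nu> - truncated_fourier f (real n) \<nu>))\<^sup>2) \<partial>lborel)" for n
  define A where "A n = (\<integral>\<^sup>+\<nu>. ennreal ((cmod (truncated_fourier f (real n) \<nu>))\<^sup>2) \<partial>lborel)" for n
  have D: "D \<longlonglongrightarrow> 0" using has_L2_fourier_sequentially[OF assms] by (simp add: D_def[abs_def])
  have A_eq: "A n = (\<integral>\<^sup>+x. ennreal ((cmod (f x))\<^sup>2) * indicator {- real n..real n} x \<partial>lborel)" if "n > 0" for n
    using plancherel_truncated[OF f] that by (simp add: A_def)
  have "(\<lambda>n. \<integral>\<^sup>+x. ennreal ((cmod (f x))\<^sup>2) * indicator {- real n..real n} x \<partial>lborel) \<longlonglongrightarrow> ?F"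
  proof (rule nn_integral_dominated_convergence[where w = "\<lambda>x. ennreal ((cmod (f x))\<^sup>2)"])
    show "AE x in lborel. (\<lambda>n. ennreal ((cmod (f x))\<^sup>2) * indicator {- real n..real n} x)
        \<longlonglongrightarrow> ennreal ((cmod (f x))\<^sup>2)"
    proof (rule AE_I2)
      fix x :: real
      obtain n0 :: nat where n0: "\<bar>x\<bar> \<le> real n0" using real_arch_simple by blast
      have "ennreal ((cmod (f x))\<^sup>2) * indicator {- real n..real n} x = ennreal ((cmod (f x))\<^sup>2)" if "n \<ge> n0" for n
        using n0 that by (auto simp: indicator_def)
      then show "(\<lambda>n. ennreal ((cmod (f x))\<^sup>2) * indicator {- real n..real n} x) \<longlonglongrightarrow> ennreal ((cmod (f x))\<^sup>2)"
        by (intro tendsto_eventually) (auto simp: eventually_sequentially)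
    qed
  qed (use L2_nn_integral_finite[OF f] in \<open>auto simp: indicator_def\<close>)
  then have A: "A \<longlonglongrightarrow> ?F"
    by (rule Lim_transform_eventually) (auto simp: A_eq eventually_sequentially intro!: exI[of _ 1])
  have lim: "(\<lambda>n. ennreal a * A n + ennreal b * D n) \<longlonglongrightarrow> ennreal a * ?F"
    "(\<lambda>n. ennreal a * ?G + ennreal b * D n) \<longlonglongrightarrow> ennreal a * ?G" for a b
    using tendsto_add[OF ennreal_tendsto_cmult[OF _ A, of "ennreal a"] ennreal_tendsto_cmult[OF _ D, of "ennreal b"]]
      tendsto_add[OF tendsto_const[of "ennreal a * ?G"] ennreal_tendsto_cmult[OF _ D, of "ennreal b"]] by simp_all
  show ?thesis
  proof (rule antisym; rule ennreal_le_of_le_weighted)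
    fix \<delta> :: real assume "\<delta> > 0"
    have "?G \<le> ennreal (1 + \<delta>) * A n + ennreal (1 + 1 / \<delta>) * D n" for n
      unfolding A_def D_def using \<open>\<delta> > 0\<close> by (intro nn_integral_cmod_square_weighted_le) auto
    then show "?G \<le> ennreal (1 + \<delta>) * ?F"
      by (intro LIMSEQ_le_const[OF lim(1)]) auto
    have "A n \<le> ennreal (1 + \<delta>) * ?G + ennreal (1 + 1 / \<delta>) * D n" for n
      unfolding A_def D_def using \<open>\<delta> > 0\<close>
      by (subst norm_minus_commute, intro nn_integral_cmod_square_weighted_le) auto
    then show "?F \<le> ennreal (1 + \<delta>) * ?G"
      by (intro LIMSEQ_le[OF A lim(2)]) auto
  qed (use L2_nn_integral_finite f g in auto)
qed

text \<open>Both candidates are L2 limits of the same truncated transforms. This is what allows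
  different spreading functions of one operator to be compared.\<close>

lemma has_L2_fourier_unique:
  assumes "has_L2_fourier f g" "has_L2_fourier f h"
  shows "AE \<nu> in lborel. g \<nu> = h \<nu>"
proof -
  have [measurable]: "f \<in> borel_measurable borel" "g \<in> borel_measurable borel" "h \<in> borel_measurable borel"
    using assms by (auto simp: has_L2_fourier_def L2_def)
  define D where "D g n = (\<integral>\<^sup>+\<nu>. ennreal ((cmod (g \<nu> - truncated_fourier f (real n) \<nu>))\<^sup>2) \<partial>lborel)" for g n
  have D: "D g \<longlonglongrightarrow> 0" "D h \<longlonglongrightarrow> 0"
    using assms[THEN has_L2_fourier_sequentially] by (simp_all add: D_def[abs_def])
  have "(\<integral>\<^sup>+\<nu>. ennreal ((cmod (g \<nu> - h \<nu>))\<^sup>2) \<partial>lborel) \<le> 2 * D g n + 2 * D h n" for n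
    unfolding D_def
    using nn_integral_cmod_diff_square_le[of g lborel "truncated_fourier f (real n)" h]
    by (simp add: norm_minus_commute)
  moreover have "(\<lambda>n. 2 * D g n + 2 * D h n) \<longlonglongrightarrow> 2 * 0 + 2 * 0"
    by (intro tendsto_add ennreal_tendsto_cmult D) auto
  ultimately have "(\<integral>\<^sup>+\<nu>. ennreal ((cmod (g \<nu> - h \<nu>))\<^sup>2) \<partial>lborel) \<le> 2 * 0 + 2 * 0"
    by (intro LIMSEQ_le_const) auto
  then have "AE \<nu> in lborel. ennreal ((cmod (g \<nu> - h \<nu>))\<^sup>2) = 0"
    by (subst nn_integral_0_iff_AE[symmetric]) auto
  then show ?thesis by (auto elim: eventually_mono)
qed

subsection \<open>Vandermonde bounds and nonuniform sampling\<close>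

lemma cmod_sum_mult_square_le:
  "(cmod (\<Sum>i\<in>I. a i * b i))\<^sup>2 \<le> (\<Sum>i\<in>I. (cmod (a i))\<^sup>2) * (\<Sum>i\<in>I. (cmod (b i))\<^sup>2)"
proof -
  have "cmod (\<Sum>i\<in>I. a i * b i) \<le> (\<Sum>i\<in>I. cmod (a i) * cmod (b i))"
    using norm_sum[of "\<lambda>i. a i * b i" I] by (simp add: norm_mult)
  then have "(cmod (\<Sum>i\<in>I. a i * b i))\<^sup>2 \<le> (\<Sum>i\<in>I. cmod (a i) * cmod (b i))\<^sup>2"
    by (intro power_mono) auto
  also have "\<dots> \<le> (\<Sum>i\<in>I. (cmod (a i))\<^sup>2) * (\<Sum>i\<in>I. (cmod (b i))\<^sup>2)"
    by (rule Cauchy_Schwarz_ineq_sum)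
  finally show ?thesis .
qed

lemma lagrange_basis_exists:
  fixes w :: "'j \<Rightarrow> 'a::field"
  assumes "finite J" "inj_on w J" "j \<in> J"
  shows "\<exists>p. degree p < card J \<and> (\<forall>i\<in>J. poly p (w i) = of_bool (i = j))"
proof -
  let ?q = "\<Prod>i\<in>J - {j}. [:- w i, 1:]"
  define p where "p = smult (inverse (poly ?q (w j))) ?q"
  have "degree ?q = card (J - {j})"
    by (subst degree_prod_eq_sum_degree) auto
  also have "\<dots> < card J" using assms by (simp only: card_Diff1_less)
  finally have "degree p < card J"
    using degree_smult_le[of "inverse (poly ?q (w j))" ?q] by (simp add: p_def)
  moreover have "poly ?q (w j) \<noteq> 0"
    using assms by (auto simp: poly_prod inj_on_def)
  moreover have "poly ?q (w i) = 0" if "i \<in> J" "i \<noteq> j" for i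
    using assms that by (auto simp: poly_prod prod_zero_iff)
  ultimately show ?thesis by (intro exI[of _ p]) (auto simp: p_def)
qed

text \<open>The difference of the two sides has degree below \<open>card J\<close> but vanishes at
  \<open>card J\<close> distinct points.\<close>

lemma lagrange_interpolation:
  fixes w :: "'j \<Rightarrow> 'a::field"
  assumes "finite J" "inj_on w J" "degree p < card J"
    and L: "\<And>j. j \<in> J \<Longrightarrow> degree (L j) < card J \<and> (\<forall>i\<in>J. poly (L j) (w i) = of_bool (i = j))"
  shows "p = (\<Sum>j\<in>J. smult (poly p (w j)) (L j))"
proof (rule ccontr)
  define q where "q = p - (\<Sum>j\<in>J. smult (poly p (w j)) (L j))"
  assume "p \<noteq> (\<Sum>j\<in>J. smult (poly p (w j)) (L j))"
  then have "q \<noteq> 0" by (simp add: q_def)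
  have "poly q (w i) = 0" if "i \<in> J" for i
  proof -
    have "(\<Sum>j\<in>J. poly p (w j) * poly (L j) (w i)) = (\<Sum>j\<in>J. if j = i then poly p (w i) else 0)"
      using L that by (intro sum.cong) auto
    then show ?thesis using that \<open>finite J\<close> by (simp add: q_def poly_sum)
  qed
  then have "w ` J \<subseteq> {x. poly q x = 0}" by auto
  then have "card (w ` J) \<le> card {x. poly q x = 0}"
    using poly_roots_finite[OF \<open>q \<noteq> 0\<close>] by (rule card_mono[rotated])
  also have "\<dots> \<le> degree q" by (rule card_poly_roots_bound[OF \<open>q \<noteq> 0\<close>])
  also have "degree q < card J"
  proof -
    have "degree (\<Sum>j\<in>J. smult (poly p (w j)) (L j)) < card J"
      using L assms(3) degree_smult_le le_less_trans
      by (intro degree_sum_less) (fastforce, auto)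
    then show ?thesis using assms(3) by (simp add: q_def degree_diff_less)
  qed
  finally show False using card_image[OF assms(2)] by simp
qed

text \<open>The coefficients of the Lagrange polynomials are the entries of the inverse matrix.
  Cauchy-Schwarz bounds both maps by the sums of squared entries: \<open>C\<close> comes from the
  matrix, \<open>K\<close> from its inverse, and the lower constant is \<open>1 / K\<close>. The
  added 1 guarantees positivity.\<close>

lemma vandermonde_bounds:
  fixes w :: "'j \<Rightarrow> complex"
  assumes "finite J" "inj_on w J"
  shows "\<exists>c C. c > 0 \<and> C > 0 \<and> (\<forall>u.
    c * (\<Sum>k<card J. (cmod (u k))\<^sup>2) \<le> (\<Sum>j\<in>J. (cmod (\<Sum>k<card J. u k * w j ^ k))\<^sup>2) \<and>
    (\<Sum>j\<in>J. (cmod (\<Sum>k<card J. u k * w j ^ k))\<^sup>2) \<le> C * (\<Sum>k<card J. (cmod (u k))\<^sup>2))"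
proof -
  let ?D = "card J"
  obtain L where L: "\<And>j. j \<in> J \<Longrightarrow> degree (L j) < ?D \<and> (\<forall>i\<in>J. poly (L j) (w i) = of_bool (i = j))"
    using lagrange_basis_exists[OF assms] by metis
  define K where "K = (\<Sum>k<?D. \<Sum>j\<in>J. (cmod (coeff (L j) k))\<^sup>2) + 1"
  define C where "C = (\<Sum>j\<in>J. \<Sum>k<?D. (cmod (w j ^ k))\<^sup>2) + 1"
  have pos: "K > 0" "C > 0" by (auto simp: K_def C_def intro!: add_nonneg_pos sum_nonneg)
  have "(\<Sum>k<?D. (cmod (u k))\<^sup>2) \<le> K * (\<Sum>j\<in>J. (cmod (\<Sum>k<?D. u k * w j ^ k))\<^sup>2)" for u
  \<comment> \<open>For an empty index set \<open>degree p < ?D\<close> would be false, so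
    interpolation is used only for nonempty \<open>J\<close>.\<close>
  proof (cases "?D = 0")
    case False
    define p where "p = (\<Sum>k<?D. monom (u k) k)"
    have poly_p: "poly p x = (\<Sum>k<?D. u k * x ^ k)" for x
      by (simp add: p_def poly_sum poly_monom)
    have "degree p < ?D"
      unfolding p_def using False degree_monom_le le_less_trans
      by (intro degree_sum_less) (blast, auto)
    then have p: "p = (\<Sum>j\<in>J. smult (poly p (w j)) (L j))"
      by (rule lagrange_interpolation[OF assms _ L])
    have coeff_p: "coeff p k = u k" if "k < ?D" for k
      using that by (simp add: p_def coeff_sum)
    have "(\<Sum>k<?D. (cmod (u k))\<^sup>2) = (\<Sum>k<?D. (cmod (\<Sum>j\<in>J. coeff (L j) k * poly p (w j)))\<^sup>2)"
    proof (intro sum.cong refl)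
      fix k assume "k \<in> {..<?D}"
      then have "u k = coeff (\<Sum>j\<in>J. smult (poly p (w j)) (L j)) k"
        using coeff_p p by auto
      then show "(cmod (u k))\<^sup>2 = (cmod (\<Sum>j\<in>J. coeff (L j) k * poly p (w j)))\<^sup>2"
        by (simp add: coeff_sum mult.commute)
    qed
    also have "\<dots> \<le> (\<Sum>k<?D. (\<Sum>j\<in>J. (cmod (coeff (L j) k))\<^sup>2) * (\<Sum>j\<in>J. (cmod (poly p (w j)))\<^sup>2))"
      by (intro sum_mono cmod_sum_mult_square_le)
    also have "\<dots> = (K - 1) * (\<Sum>j\<in>J. (cmod (poly p (w j)))\<^sup>2)"
      by (simp add: K_def sum_distrib_right)
    also have "\<dots> \<le> K * (\<Sum>j\<in>J. (cmod (poly p (w j)))\<^sup>2)"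
      by (intro mult_right_mono sum_nonneg) auto
    finally show ?thesis by (simp add: poly_p)
  qed (use pos in \<open>simp add: sum_nonneg\<close>)
  moreover have "(\<Sum>j\<in>J. (cmod (\<Sum>k<?D. u k * w j ^ k))\<^sup>2) \<le> C * (\<Sum>k<?D. (cmod (u k))\<^sup>2)" for u
  proof -
    have "(\<Sum>j\<in>J. (cmod (\<Sum>k<?D. u k * w j ^ k))\<^sup>2)
        \<le> (\<Sum>j\<in>J. (\<Sum>k<?D. (cmod (u k))\<^sup>2) * (\<Sum>k<?D. (cmod (w j ^ k))\<^sup>2))"
      by (intro sum_mono cmod_sum_mult_square_le)
    also have "\<dots> = (C - 1) * (\<Sum>k<?D. (cmod (u k))\<^sup>2)"
      by (simp add: C_def sum_distrib_left mult.commute)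
    also have "\<dots> \<le> C * (\<Sum>k<?D. (cmod (u k))\<^sup>2)"
      by (intro mult_right_mono sum_nonneg) auto
    finally show ?thesis .
  qed
  ultimately show ?thesis
    using pos by (intro exI[of _ "1 / K"] exI[of _ C]) (simp add: field_simps)
qed

section \<open>Folding a band into consecutive pieces\<close>

lemma sum_indicator_translates:
  assumes "p > (0::real)"
  shows "(\<Sum>k<D. indicator {a..<a+p} (x - real k * p)) = (indicator {a..<a + real D * p} x :: 'a::semiring_1)"
proof (induction D)
  case (Suc D)
  have "indicator {a..<a + real (Suc D) * p} x
      = (indicator {a..<a + real D * p} x + indicator {a..<a+p} (x - real D * p) :: 'a)"
    using assms by (auto simp: indicator_def algebra_simps) (smt (verit) mult_nonneg_nonneg of_nat_0_le_iff)+
  then show ?case using Suc by simp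
qed simp

lemma AE_zero_outside_half_open:
  assumes "AE x in lborel. x \<notin> {a..b::real} \<longrightarrow> g x = 0"
  shows "AE x in lborel. x \<notin> {a..<b} \<longrightarrow> g x = 0"
  using assms AE_lborel_singleton[of b] by eventually_elim auto

text \<open>\<open>D\<close> consecutive half-open pieces of length \<open>p\<close> tile the
  support up to its right endpoint, a null set; each piece is translated back to the first
  one.\<close>

lemma nn_integral_fold:
  fixes g :: "real \<Rightarrow> ennreal"
  assumes [measurable]: "g \<in> borel_measurable borel" and "p > 0"
    and supp: "AE x in lborel. x \<notin> {a..a + real D * p} \<longrightarrow> g x = 0"
  shows "(\<integral>\<^sup>+x. g x \<partial>lborel) = (\<integral>\<^sup>+x\<in>{a..<a+p}. (\<Sum>k<D. g (x + real k * p)) \<partial>lborel)"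
proof -
  have "(\<integral>\<^sup>+x\<in>{a..<a+p}. (\<Sum>k<D. g (x + real k * p)) \<partial>lborel)
      = (\<Sum>k<D. \<integral>\<^sup>+x. g (x + real k * p) * indicator {a..<a+p} x \<partial>lborel)"
    unfolding sum_distrib_right by (rule nn_integral_sum) auto
  also have "\<dots> = (\<Sum>k<D. \<integral>\<^sup>+x. g x * indicator {a..<a+p} (x - real k * p) \<partial>lborel)"
  proof (intro sum.cong refl)
    fix k
    show "(\<integral>\<^sup>+x. g (x + real k * p) * indicator {a..<a+p} x \<partial>lborel)
        = (\<integral>\<^sup>+x. g x * indicator {a..<a+p} (x - real k * p) \<partial>lborel)"
      by (subst nn_integral_real_affine[of _ 1 "- (real k * p)"]) (auto simp: algebra_simps)
  qed
  also have "\<dots> = (\<integral>\<^sup>+x. g x * indicator {a..<a + real D * p} x \<partial>lborel)"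
    by (simp add: nn_integral_sum[symmetric] sum_distrib_left[symmetric] sum_indicator_translates[OF \<open>p > 0\<close>])
  also have "\<dots> = (\<integral>\<^sup>+x. g x \<partial>lborel)"
    using AE_zero_outside_half_open[OF supp]
    by (intro nn_integral_cong_AE) (auto elim!: eventually_mono simp: indicator_def)
  finally show ?thesis by simp
qed

lemma integral_fold:
  fixes g :: "real \<Rightarrow> complex"
  assumes g: "integrable lborel g" and "p > 0"
    and supp: "AE x in lborel. x \<notin> {a..a + real D * p} \<longrightarrow> g x = 0"
  shows "(LINT x|lborel. g x) = (LINT x:{a..<a+p}|lborel. (\<Sum>k<D. g (x + real k * p)))"
proof -
  have [measurable]: "g \<in> borel_measurable borel" using g by auto
  have g': "integrable lborel (\<lambda>x. g (x + real k * p))" for k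
    using lborel_integrable_real_affine[OF g, of 1 "real k * p"] by (simp add: add.commute)
  have "(LINT x:{a..<a+p}|lborel. (\<Sum>k<D. g (x + real k * p)))
      = (\<Sum>k<D. LINT x|lborel. indicator {a..<a+p} x *\<^sub>R g (x + real k * p))"
    unfolding set_lebesgue_integral_def scaleR_sum_right
    by (intro Bochner_Integration.integral_sum integrable_mult_indicator g') auto
  also have "\<dots> = (\<Sum>k<D. LINT x|lborel. indicator {a..<a+p} (x - real k * p) *\<^sub>R g x)"
  proof (intro sum.cong refl)
    fix k
    show "(LINT x|lborel. indicator {a..<a+p} x *\<^sub>R g (x + real k * p))
        = (LINT x|lborel. indicator {a..<a+p} (x - real k * p) *\<^sub>R g x)"
      by (subst lborel_integral_real_affine[of 1 _ "- (real k * p)"]) (auto simp: algebra_simps)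
  qed
  also have "\<dots> = (LINT x|lborel. (\<Sum>k<D. indicator {a..<a+p} (x - real k * p) *\<^sub>R g x))"
  proof (rule Bochner_Integration.integral_sum[symmetric])
    fix k
    show "integrable lborel (\<lambda>x. indicat_real {a..<a+p} (x - real k * p) *\<^sub>R g x)"
      by (rule Bochner_Integration.integrable_bound[OF g]) (auto simp: indicator_def)
  qed
  also have "\<dots> = (LINT x|lborel. indicator {a..<a + real D * p} x *\<^sub>R g x)"
    by (simp add: scaleR_sum_left[symmetric] sum_indicator_translates[OF \<open>p > 0\<close>])
  also have "\<dots> = (LINT x|lborel. g x)"
    using AE_zero_outside_half_open[OF supp]
    by (intro integral_cong_AE) (auto elim!: eventually_mono simp: indicator_def)
  finally show ?thesis by simp
qed

lemma parseval_half_open_interval: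
  assumes [measurable]: "f \<in> borel_measurable borel" and "P > 0"
    and fin: "(\<integral>\<^sup>+x\<in>{a..<a+P}. ennreal ((cmod (f x))\<^sup>2) \<partial>lborel) < \<infinity>"
  shows "(\<integral>\<^sup>+k. ennreal ((cmod (LINT x:{a..<a+P}|lborel. f x * cis (2 * pi * of_int k * x / P)))\<^sup>2)
    \<partial>count_space UNIV) = ennreal P * (\<integral>\<^sup>+x\<in>{a..<a+P}. ennreal ((cmod (f x))\<^sup>2) \<partial>lborel)"
proof -
  have AE: "AE x in lborel. x \<noteq> a + P" by (rule AE_lborel_singleton)
  have nn: "(\<integral>\<^sup>+x\<in>{a..<a+P}. ennreal ((cmod (f x))\<^sup>2) \<partial>lborel)
      = (\<integral>\<^sup>+x\<in>{a..a+P}. ennreal ((cmod (f x))\<^sup>2) \<partial>lborel)"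
    using AE by (intro nn_integral_cong_AE) (auto elim!: eventually_mono simp: indicator_def)
  have "(LINT x:{a..<a+P}|lborel. f x * cis (2 * pi * of_int k * x / P))
      = (LINT x:{a..a+P}|lborel. f x * cis (2 * pi * of_int k * x / P))" for k
    unfolding set_lebesgue_integral_def
    using AE by (intro integral_cong_AE) (auto elim!: eventually_mono simp: indicator_def)
  then show ?thesis
    using parseval_interval[OF assms(1,2), of a] fin by (simp only: nn)
qed

text \<open>On a bounded band square integrability implies integrability, since y \<le> 1 + y^2.
  Hence the inverse Fourier integrals of \<open>F\<close> converge absolutely and can be
  folded.\<close>

lemma band_limited_integrable:
  fixes F :: "real \<Rightarrow> complex"
  assumes [measurable]: "F \<in> borel_measurable borel"
    and fin: "(\<integral>\<^sup>+\<nu>. ennreal ((cmod (F \<nu>))\<^sup>2) \<partial>lborel) < \<infinity>"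
    and supp: "AE \<nu> in lborel. \<nu> \<notin> {a..b} \<longrightarrow> F \<nu> = 0"
  shows "integrable lborel F"
proof -
  have "integrable lborel (\<lambda>\<nu>. (cmod (F \<nu>))\<^sup>2)"
    using fin by (intro integrableI_nonneg) (auto simp: less_top)
  moreover have "integrable lborel (indicat_real {a..b})"
    by (cases "a \<le> b") (auto simp: integrable_indicator_iff emeasure_lborel_Icc)
  ultimately have "integrable lborel (\<lambda>\<nu>. indicat_real {a..b} \<nu> + (cmod (F \<nu>))\<^sup>2)"
    by (rule Bochner_Integration.integrable_add[rotated])
  then show ?thesis
  proof (rule Bochner_Integration.integrable_bound)
    show "AE \<nu> in lborel. cmod (F \<nu>) \<le> norm (indicat_real {a..b} \<nu> + (cmod (F \<nu>))\<^sup>2)"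
      using supp
    proof eventually_elim
      case (elim \<nu>)
      have "y \<le> 1 + y\<^sup>2" if "y \<ge> 0" for y :: real
        using sum_squares_bound[of 1 y] that by simp
      then show ?case using elim by (auto simp: indicator_def add_nonneg_nonneg)
    qed
  qed auto
qed

text \<open>
  Periodic nonuniform sampling at the critical density: on each fibre \<open>\<nu> + \<int>/N\<close> of the
  band the samples see \<open>F\<close> through a Vandermonde matrix with nodes \<open>cis (2 * pi * \<alpha> j / N)\<close>,
  which does not depend on the common shift \<open>t\<close>.
\<close>

lemma sampling_bounds:
  fixes M N :: nat and \<alpha> :: "'j \<Rightarrow> real"
  assumes "N \<ge> 1" and J: "finite J" "card J = M * N" and inj: "inj_on \<alpha> J"
    and range: "\<And>j. j \<in> J \<Longrightarrow> 0 \<le> \<alpha> j \<and> \<alpha> j < real N"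
  shows "\<exists>c C. c > 0 \<and> C > 0 \<and> (\<forall>t F. F \<in> borel_measurable borel \<longrightarrow>
    (\<integral>\<^sup>+\<nu>. ennreal ((cmod (F \<nu>))\<^sup>2) \<partial>lborel) < \<infinity> \<longrightarrow>
    (AE \<nu> in lborel. \<nu> \<notin> {- (real M / 2)..real M / 2} \<longrightarrow> F \<nu> = 0) \<longrightarrow>
    ennreal c * (\<integral>\<^sup>+\<nu>. ennreal ((cmod (F \<nu>))\<^sup>2) \<partial>lborel)
      \<le> (\<Sum>j\<in>J. \<integral>\<^sup>+n. ennreal ((cmod (LINT \<nu>|lborel. F \<nu> *
          cis (2 * pi * (t + (of_int n * real N + \<alpha> j)) * \<nu>)))\<^sup>2) \<partial>count_space (UNIV :: int set)) \<and>
    (\<Sum>j\<in>J. \<integral>\<^sup>+n. ennreal ((cmod (LINT \<nu>|lborel. F \<nu> *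
          cis (2 * pi * (t + (of_int n * real N + \<alpha> j)) * \<nu>)))\<^sup>2) \<partial>count_space (UNIV :: int set))
      \<le> ennreal C * (\<integral>\<^sup>+\<nu>. ennreal ((cmod (F \<nu>))\<^sup>2) \<partial>lborel))"
proof -
  let ?D = "M * N"
  define p where "p = 1 / real N"
  define a where "a = - (real M / 2)"
  have p: "p > 0" "real N * p = 1" using assms(1) by (auto simp: p_def)
  have aD: "a + real ?D * p = real M / 2" using assms(1) by (simp add: a_def p_def)
  define w where "w j = cis (2 * pi * \<alpha> j * p)" for j
  have "inj_on w J"
  proof (rule inj_onI)
    fix i j assume ij: "i \<in> J" "j \<in> J" "w i = w j"
    \<comment> \<open>Since 0 \<le> \<open>\<alpha> k\<close> < \<open>N\<close>, the angle lies in
      [0, 2 \<pi>) and can be read back from the node.\<close>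
    have "Arg2pi (w k) = 2 * pi * \<alpha> k * p" if "k \<in> J" for k
      unfolding w_def using range[OF that] assms(1) by (intro Arg2pi_cis) (auto simp: p_def field_simps)
    then have "2 * pi * \<alpha> i * p = 2 * pi * \<alpha> j * p" using ij by metis
    then have "\<alpha> i = \<alpha> j" using p by simp
    then show "i = j" using inj ij by (auto dest: inj_onD)
  qed
  from vandermonde_bounds[OF J(1) this] obtain c C where cC: "c > 0" "C > 0"
    and lower: "\<And>u. c * (\<Sum>k<?D. (cmod (u k))\<^sup>2) \<le> (\<Sum>j\<in>J. (cmod (\<Sum>k<?D. u k * w j ^ k))\<^sup>2)"
    and upper: "\<And>u. (\<Sum>j\<in>J. (cmod (\<Sum>k<?D. u k * w j ^ k))\<^sup>2) \<le> C * (\<Sum>k<?D. (cmod (u k))\<^sup>2)"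
    unfolding J(2) by auto
  have main: "ennreal (p * c) * (\<integral>\<^sup>+\<nu>. ennreal ((cmod (F \<nu>))\<^sup>2) \<partial>lborel)
      \<le> (\<Sum>j\<in>J. \<integral>\<^sup>+n. ennreal ((cmod (LINT \<nu>|lborel. F \<nu> *
          cis (2 * pi * (t + (of_int n * real N + \<alpha> j)) * \<nu>)))\<^sup>2) \<partial>count_space (UNIV :: int set)) \<and>
    (\<Sum>j\<in>J. \<integral>\<^sup>+n. ennreal ((cmod (LINT \<nu>|lborel. F \<nu> *
          cis (2 * pi * (t + (of_int n * real N + \<alpha> j)) * \<nu>)))\<^sup>2) \<partial>count_space (UNIV :: int set))
      \<le> ennreal (p * C) * (\<integral>\<^sup>+\<nu>. ennreal ((cmod (F \<nu>))\<^sup>2) \<partial>lborel)" (is "_ * ?F \<le> (\<Sum>j\<in>J. ?S j) \<and> _")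
    if [measurable]: "F \<in> borel_measurable borel" and fin: "(\<integral>\<^sup>+\<nu>. ennreal ((cmod (F \<nu>))\<^sup>2) \<partial>lborel) < \<infinity>"
      and supp: "AE \<nu> in lborel. \<nu> \<notin> {- (real M / 2)..real M / 2} \<longrightarrow> F \<nu> = 0" for F t
  proof -
    have supp': "AE \<nu> in lborel. \<nu> \<notin> {a..a + real ?D * p} \<longrightarrow> F \<nu> = 0"
      using supp unfolding aD by (simp add: a_def)
    have int_F: "integrable lborel F" by (rule band_limited_integrable[OF that])
    \<comment> \<open>The phase due to \<open>t\<close> goes into the unknowns \<open>u\<close>,
      whose moduli stay those of \<open>F\<close>. Up to a common unimodular factor,
      \<open>G j\<close> is then the \<open>j\<close>-th Vandermonde row applied to
      \<open>u\<close>.\<close>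
    define u where "u \<nu> k = F (\<nu> + real k * p) * cis (2 * pi * t * (\<nu> + real k * p))" for \<nu> k
    define G where "G j \<nu> = (\<Sum>k<?D. F (\<nu> + real k * p) * cis (2 * pi * (t + \<alpha> j) * (\<nu> + real k * p)))" for j \<nu>
    have [measurable]: "G j \<in> borel_measurable borel" for j unfolding G_def by measurable
    have norm_u: "cmod (u \<nu> k) = cmod (F (\<nu> + real k * p))" for \<nu> k
      by (simp add: u_def norm_mult)
    have norm_G: "cmod (G j \<nu>) = cmod (\<Sum>k<?D. u \<nu> k * w j ^ k)" for j \<nu>
    proof -
      have "G j \<nu> = cis (2 * pi * \<alpha> j * \<nu>) * (\<Sum>k<?D. u \<nu> k * w j ^ k)"
        unfolding G_def sum_distrib_left
      proof (intro sum.cong refl)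
        fix k
        have "cis (2 * pi * (t + \<alpha> j) * (\<nu> + real k * p))
            = cis (2 * pi * \<alpha> j * \<nu>) * (cis (2 * pi * t * (\<nu> + real k * p)) * w j ^ k)"
          by (simp add: w_def Complex.DeMoivre cis_mult algebra_simps)
        then show "F (\<nu> + real k * p) * cis (2 * pi * (t + \<alpha> j) * (\<nu> + real k * p))
            = cis (2 * pi * \<alpha> j * \<nu>) * (u \<nu> k * w j ^ k)"
          by (simp add: u_def mult_ac)
      qed
      then show ?thesis by (simp add: norm_mult)
    qed
    have fold: "?F = (\<integral>\<^sup>+\<nu>\<in>{a..<a+p}. ennreal (\<Sum>k<?D. (cmod (u \<nu> k))\<^sup>2) \<partial>lborel)"
      using supp' nn_integral_fold[OF _ p(1), of "\<lambda>\<nu>. ennreal ((cmod (F \<nu>))\<^sup>2)" a ?D]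
      by (auto simp: norm_u sum_ennreal elim: eventually_mono)
    have [measurable]: "(\<lambda>\<nu>. \<Sum>k<?D. (cmod (u \<nu> k))\<^sup>2) \<in> borel_measurable borel"
      unfolding norm_u by measurable
    have G_upper: "(\<Sum>j\<in>J. (cmod (G j \<nu>))\<^sup>2) \<le> C * (\<Sum>k<?D. (cmod (u \<nu> k))\<^sup>2)" for \<nu>
      using upper[of "u \<nu>"] by (simp only: norm_G)
    have G_lower: "c * (\<Sum>k<?D. (cmod (u \<nu> k))\<^sup>2) \<le> (\<Sum>j\<in>J. (cmod (G j \<nu>))\<^sup>2)" for \<nu>
      using lower[of "u \<nu>"] by (simp only: norm_G)
    let ?I = "\<lambda>j. \<integral>\<^sup>+\<nu>\<in>{a..<a+p}. ennreal ((cmod (G j \<nu>))\<^sup>2) \<partial>lborel"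
    have sum_I: "(\<Sum>j\<in>J. ?I j) = (\<integral>\<^sup>+\<nu>\<in>{a..<a+p}. ennreal (\<Sum>j\<in>J. (cmod (G j \<nu>))\<^sup>2) \<partial>lborel)"
      by (simp add: nn_integral_sum[symmetric] sum_distrib_right[symmetric] sum_ennreal)
    have cmult: "ennreal r * ?F = (\<integral>\<^sup>+\<nu>\<in>{a..<a+p}. ennreal (r * (\<Sum>k<?D. (cmod (u \<nu> k))\<^sup>2)) \<partial>lborel)"
      if "r > 0" for r
      unfolding fold using that by (simp add: nn_integral_cmult[symmetric] ennreal_mult' mult.assoc)
    have I_upper: "(\<Sum>j\<in>J. ?I j) \<le> ennreal C * ?F"
      unfolding sum_I cmult[OF cC(2)]
      by (intro nn_integral_mono mult_right_mono ennreal_leI G_upper) auto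
    have I_lower: "ennreal c * ?F \<le> (\<Sum>j\<in>J. ?I j)"
      unfolding sum_I cmult[OF cC(1)]
      by (intro nn_integral_mono mult_right_mono ennreal_leI G_lower) auto
    have S: "?S j = ennreal p * ?I j" if "j \<in> J" for j
    proof -
      have coeff: "(LINT \<nu>|lborel. F \<nu> * cis (2 * pi * (t + (of_int n * real N + \<alpha> j)) * \<nu>))
          = (LINT \<nu>:{a..<a+p}|lborel. G j \<nu> * cis (2 * pi * of_int n * \<nu> / p))" for n :: int
      proof -
        let ?g = "\<lambda>\<nu>. F \<nu> * cis (2 * pi * (t + (of_int n * real N + \<alpha> j)) * \<nu>)"
        have "integrable lborel ?g"
          by (rule Bochner_Integration.integrable_bound[OF int_F]) (auto simp: norm_mult)
        then have "(LINT \<nu>|lborel. ?g \<nu>) = (LINT \<nu>:{a..<a+p}|lborel. \<Sum>k<?D. ?g (\<nu> + real k * p))"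
          using supp' by (intro integral_fold p(1)) (auto elim: eventually_mono)
        also have "(\<lambda>\<nu>. \<Sum>k<?D. ?g (\<nu> + real k * p)) = (\<lambda>\<nu>. G j \<nu> * cis (2 * pi * of_int n * \<nu> / p))"
          unfolding G_def sum_distrib_right
        proof (intro ext sum.cong refl)
          fix \<nu> k
          \<comment> \<open>As \<open>N * p = 1\<close>, the cross term \<open>n * N * k * p\<close>
            is the integer \<open>n * k\<close> and contributes a full number of turns. What remains
            of the \<open>n\<close>-dependence is a Fourier mode of period \<open>p\<close>, common
            to all pieces.\<close>
          have "2 * pi * (t + (of_int n * real N + \<alpha> j)) * (\<nu> + real k * p)
              = 2 * pi * (t + \<alpha> j) * (\<nu> + real k * p) + 2 * pi * of_int n * \<nu> / p + 2 * pi * of_int (n * int k)"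
            using assms(1) by (simp add: p_def field_simps)
          then show "?g (\<nu> + real k * p) = F (\<nu> + real k * p) *
              cis (2 * pi * (t + \<alpha> j) * (\<nu> + real k * p)) * cis (2 * pi * of_int n * \<nu> / p)"
            using cis_multiple_2pi[of "of_int (n * int k)"] by (simp only: cis_mult[symmetric] mult.assoc) simp
        qed
        finally show ?thesis .
      qed
      \<comment> \<open>Parseval requires \<open>G j\<close> to have finite norm on the first piece;
        the upper Vandermonde bound supplies it.\<close>
      have "?I j \<le> (\<Sum>j\<in>J. ?I j)" using that J(1) by (intro member_le_sum) auto
      also have "\<dots> \<le> ennreal C * ?F" by (rule I_upper)
      also have "\<dots> < \<infinity>" using fin by (simp add: ennreal_mult_less_top)
      finally show ?thesis
        unfolding coeff by (intro parseval_half_open_interval p(1)) auto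
    qed
    have "(\<Sum>j\<in>J. ?S j) = ennreal p * (\<Sum>j\<in>J. ?I j)"
      by (simp add: S sum_distrib_left)
    moreover have "ennreal (p * r) * ?F = ennreal p * (ennreal r * ?F)" if "r > 0" for r
      using that p(1) by (simp add: ennreal_mult' mult.assoc)
    ultimately show ?thesis
      using I_lower I_upper cC by (auto intro: mult_left_mono)
  qed
  show ?thesis
    using main p(1) cC by (intro exI[of _ "p * c"] exI[of _ "p * C"]) auto
qed

subsection \<open>Comb responses of operators in \<open>OPW\<close>\<close>

text \<open>Summability and absolute summability coincide for complex families, and both sides are 0
  when it fails. Sums over integers thus become parameter integrals, from which measurability of the
  comb response follows without a summability argument.\<close>

lemma infsum_complex_eq_integral:
  fixes f :: "'i \<Rightarrow> complex"
  shows "infsum f A = (LINT i|count_space A. f i)"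
proof (cases "f summable_on A")
  case True
  then have "Infinite_Set_Sum.abs_summable_on f A"
    using summable_on_iff_abs_summable_on_complex abs_summable_equivalent by blast
  from infsetsum_infsum[OF this] show ?thesis by (simp add: infsetsum_def)
next
  case False
  then have "\<not> integrable (count_space A) f"
    using summable_on_iff_abs_summable_on_complex abs_summable_equivalent
    by (metis abs_summable_on_def)
  then show ?thesis using False by (simp add: infsum_not_exists not_integrable_integral_eq)
qed

lemma borel_measurable_infsum_complex:
  fixes f :: "'i::countable \<Rightarrow> 'a \<Rightarrow> complex"
  assumes "\<And>i. f i \<in> borel_measurable M"
  shows "(\<lambda>x. \<Sum>\<^sub>\<infinity>i. f i x) \<in> borel_measurable M"
proof -
  interpret C: sigma_finite_measure "count_space (UNIV :: 'i set)"
    by (rule sigma_finite_measure_count_space)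
  have "(\<lambda>(i, x). f i x) \<in> borel_measurable (count_space UNIV \<Otimes>\<^sub>M M)"
    by (rule measurable_pair_measure_countable1) (use assms in auto)
  then have "(\<lambda>(x, i). f i x) \<in> borel_measurable (M \<Otimes>\<^sub>M count_space UNIV)"
    using measurable_pair_swap[of "\<lambda>(i, x). f i x"] by (simp add: split_beta')
  then show ?thesis
    unfolding infsum_complex_eq_integral by (rule C.borel_measurable_lebesgue_integral)
qed

lemma AE_lborel_translate:
  assumes "AE x in lborel. P (x :: real)"
  shows "AE x in lborel. P (x - c)"
proof -
  obtain N where N: "{x \<in> space lborel. \<not> P x} \<subseteq> N" "N \<in> null_sets lborel"
    using assms unfolding eventually_ae_filter by auto
  then have [measurable]: "N \<in> sets borel" by auto
  have "AE x in lborel. - c + 1 * x \<notin> N"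
    using AE_not_in[OF N(2)] by (intro AE_borel_affine) auto
  then show ?thesis by (rule eventually_mono) (use N(1) in \<open>auto simp: algebra_simps\<close>)
qed

text \<open>The union of open sets behind \<open>ess_support\<close> may be uncountable; Lindelof's
  theorem extracts a countable subfamily with the same union, so the exceptional null sets can be
  collected.\<close>

lemma AE_zero_outside_ess_support: "AE z in lborel. z \<notin> ess_support \<eta> \<longrightarrow> \<eta> z = 0"
proof -
  let ?F = "{U. open U \<and> (AE z in lborel. z \<in> U \<longrightarrow> \<eta> z = 0)}"
  obtain F' where F': "F' \<subseteq> ?F" "countable F'" "\<Union>F' = \<Union>?F"
    using Lindelof[of ?F] by auto
  have "AE z in lborel. \<forall>U\<in>F'. z \<in> U \<longrightarrow> \<eta> z = 0"
    using F'(1) by (subst AE_ball_countable[OF F'(2)]) auto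
  then show ?thesis
    by eventually_elim (use F'(3) in \<open>auto simp: ess_support_def\<close>)
qed

lemma AE_lborel_pair:
  assumes "AE z in lborel. P (z :: real \<times> real)"
  shows "AE x in lborel. AE y in lborel. P (x, y)"
  by (rule lborel_pair.AE_pair) (unfold lborel_prod, rule assms)

lemma nn_integral_lborel_pair:
  fixes f :: "real \<times> real \<Rightarrow> ennreal"
  assumes "f \<in> borel_measurable borel"
  shows "(\<integral>\<^sup>+z. f z \<partial>lborel) = (\<integral>\<^sup>+x. (\<integral>\<^sup>+y. f (x, y) \<partial>lborel) \<partial>lborel)"
  using lborel.nn_integral_fst[of f lborel] assms by (simp add: lborel_prod)

section \<open>Norm and support in terms of the spreading function\<close>

lemma has_kernel_kernel: "H \<in> HS \<Longrightarrow> has_kernel H (kernel H)"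
  unfolding HS_def kernel_def using someI_ex[of "has_kernel H"] by simp

lemma has_spreading_function_spreading_function:
  "has_spreading_function H \<eta> \<Longrightarrow> has_spreading_function H (spreading_function H)"
  unfolding spreading_function_def by (rule someI[of "has_spreading_function H"])

text \<open>For fixed \<open>x\<close> the reflection \<open>y = x - t\<close> preserves Lebesgue
  measure; after Tonelli, Plancherel applies on almost every slice in \<open>t\<close>.\<close>

lemma HS_norm_eq_spreading:
  assumes "H \<in> HS" and \<eta>: "has_spreading_function H \<eta>"
  shows "ennreal ((HS_norm H)\<^sup>2) = (\<integral>\<^sup>+t. (\<integral>\<^sup>+\<nu>. ennreal ((cmod (\<eta> (t, \<nu>)))\<^sup>2) \<partial>lborel) \<partial>lborel)"
proof -
  have \<kappa>: "kernel H \<in> L2 lborel"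
    using has_kernel_kernel[OF assms(1)] by (simp add: has_kernel_def)
  then have [measurable]: "kernel H \<in> borel_measurable borel" by (simp add: L2_def)
  have "ennreal ((HS_norm H)\<^sup>2) = (\<integral>\<^sup>+z. ennreal ((cmod (kernel H z))\<^sup>2) \<partial>lborel)"
    unfolding HS_norm_def by (rule L2_norm_nn_integral[OF \<kappa>])
  also have "\<dots> = (\<integral>\<^sup>+x. (\<integral>\<^sup>+y. ennreal ((cmod (kernel H (x, y)))\<^sup>2) \<partial>lborel) \<partial>lborel)"
    by (rule nn_integral_lborel_pair) simp
  also have "\<dots> = (\<integral>\<^sup>+x. (\<integral>\<^sup>+t. ennreal ((cmod (kernel H (x, x - t)))\<^sup>2) \<partial>lborel) \<partial>lborel)"
  proof (rule nn_integral_cong)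
    fix x :: real
    show "(\<integral>\<^sup>+y. ennreal ((cmod (kernel H (x, y)))\<^sup>2) \<partial>lborel)
        = (\<integral>\<^sup>+t. ennreal ((cmod (kernel H (x, x - t)))\<^sup>2) \<partial>lborel)"
      by (subst nn_integral_real_affine[of _ "- 1" x]) auto
  qed
  also have "\<dots> = (\<integral>\<^sup>+t. (\<integral>\<^sup>+x. ennreal ((cmod (kernel H (x, x - t)))\<^sup>2) \<partial>lborel) \<partial>lborel)"
    by (rule lborel_pair.Fubini') measurable
  also have "\<dots> = (\<integral>\<^sup>+t. (\<integral>\<^sup>+\<nu>. ennreal ((cmod (\<eta> (t, \<nu>)))\<^sup>2) \<partial>lborel) \<partial>lborel)"
  proof (rule nn_integral_cong_AE)
    have "AE t in lborel. has_L2_fourier (impulse_response H t) (\<lambda>\<nu>. \<eta> (t, \<nu>))"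
      using \<eta> by (simp add: has_spreading_function_def)
    then show "AE t in lborel. (\<integral>\<^sup>+x. ennreal ((cmod (kernel H (x, x - t)))\<^sup>2) \<partial>lborel)
        = (\<integral>\<^sup>+\<nu>. ennreal ((cmod (\<eta> (t, \<nu>)))\<^sup>2) \<partial>lborel)"
      by eventually_elim (simp add: plancherel impulse_response_def)
  qed
  finally show ?thesis .
qed

text \<open>\<open>OPW\<close> provides some spreading function supported in \<open>S\<close>,
  whereas the comb response uses the chosen one. On almost every slice both are Fourier transforms
  of the same impulse response, so the vanishing carries over.\<close>

lemma OPW_spreading_zero:
  assumes "H \<in> OPW S"
  shows "AE t in lborel. AE \<nu> in lborel. (t, \<nu>) \<notin> S \<longrightarrow> spreading_function H (t, \<nu>) = 0"
proof -
  obtain \<eta> where \<eta>: "has_spreading_function H \<eta>" "ess_support \<eta> \<subseteq> S"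
    using assms by (auto simp: OPW_def)
  have "AE z in lborel. z \<notin> S \<longrightarrow> \<eta> z = 0"
    using AE_zero_outside_ess_support[of \<eta>] by eventually_elim (use \<eta>(2) in auto)
  then have "AE t in lborel. AE \<nu> in lborel. (t, \<nu>) \<notin> S \<longrightarrow> \<eta> (t, \<nu>) = 0"
    by (rule AE_lborel_pair)
  moreover have "AE t in lborel. has_L2_fourier (impulse_response H t) (\<lambda>\<nu>. \<eta> (t, \<nu>))"
    "AE t in lborel. has_L2_fourier (impulse_response H t) (\<lambda>\<nu>. spreading_function H (t, \<nu>))"
    using \<eta>(1) has_spreading_function_spreading_function[OF \<eta>(1)]
    by (simp_all add: has_spreading_function_def)
  ultimately show ?thesis
  proof eventually_elim
    case (elim t)
    show ?case
      using elim(1) has_L2_fourier_unique[OF elim(2,3)] by eventually_elim simp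
  qed
qed

lemma borel_measurable_cont_impulse_response:
  assumes [measurable]: "spreading_function H \<in> borel_measurable borel"
  shows "(\<lambda>(t, x). cont_impulse_response H t x) \<in> borel_measurable borel"
proof -
  have "(\<lambda>z. LINT \<nu>|lborel. spreading_function H (fst z, \<nu>) * cis (2 * pi * snd z * \<nu>))
      \<in> borel_measurable (borel \<Otimes>\<^sub>M borel)"
    by measurable
  then show ?thesis
    by (simp add: cont_impulse_response_def exp_eq_cis split_beta' borel_prod)
qed

text \<open>
  Almost everywhere at most one term of the series defining \<open>apply_shifted_comb\<close> is nonzero,
  because the translates of \<open>[0, T)\<close> by multiples of \<open>T\<close> are disjoint.
\<close>

lemma apply_shifted_comb_nn_integral:
  assumes [measurable]: "spreading_function H \<in> borel_measurable borel" and "T > 0"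
    and zero: "AE t in lborel. t \<notin> {0..T} \<longrightarrow> (\<forall>x. cont_impulse_response H t x = 0)"
  shows "apply_shifted_comb H T a \<in> borel_measurable borel"
    and "(\<integral>\<^sup>+x. ennreal ((cmod (apply_shifted_comb H T a x))\<^sup>2) \<partial>lborel)
      = (\<integral>\<^sup>+t. (\<integral>\<^sup>+n. ennreal ((cmod (cont_impulse_response H t (t + (of_int n * T + a))))\<^sup>2)
          \<partial>count_space (UNIV :: int set)) \<partial>lborel)"
proof -
  let ?h = "cont_impulse_response H"
  have h: "(\<lambda>(t, x). ?h t x) \<in> borel_measurable borel"
    by (rule borel_measurable_cont_impulse_response) simp
  have [measurable]: "(\<lambda>x. ?h (f x) (g x)) \<in> borel_measurable borel"
    if [measurable]: "f \<in> borel_measurable borel" "g \<in> borel_measurable borel" for f g :: "real \<Rightarrow> real"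
    using measurable_compose[OF borel_measurable_Pair[OF that] h] by simp
  have comb: "apply_shifted_comb H T a = (\<lambda>x. \<Sum>\<^sub>\<infinity>n. ?h (x - (of_int n * T + a)) x)"
    by (simp add: fun_eq_iff apply_shifted_comb_def apply_deltas_def)
  show "apply_shifted_comb H T a \<in> borel_measurable borel"
    unfolding comb by (intro borel_measurable_infsum_complex) measurable
  have sf: "sigma_finite_measure (lborel :: real measure)" by unfold_locales
  have zero': "AE t in lborel. t \<notin> {0..<T} \<longrightarrow> (\<forall>x. ?h t x = 0)"
    using zero AE_lborel_singleton[of T] by eventually_elim auto
  \<comment> \<open>There are countably many \<open>n\<close>, so one null set of \<open>x\<close>
    serves all terms of the series.\<close>
  have "AE x in lborel. \<forall>n::int. x - (of_int n * T + a) \<notin> {0..<T} \<longrightarrow> ?h (x - (of_int n * T + a)) x = 0"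
    unfolding AE_all_countable
  proof
    fix n :: int
    show "AE x in lborel. x - (of_int n * T + a) \<notin> {0..<T} \<longrightarrow> ?h (x - (of_int n * T + a)) x = 0"
      using AE_lborel_translate[OF zero', of "of_int n * T + a"] by eventually_elim blast
  qed
  \<comment> \<open>Only the term with \<open>n0\<close> can survive, so the squared modulus of the
    series is the sum of the squared moduli, without cross terms.\<close>
  then have "AE x in lborel. ennreal ((cmod (apply_shifted_comb H T a x))\<^sup>2)
      = (\<integral>\<^sup>+n. ennreal ((cmod (?h (x - (of_int n * T + a)) x))\<^sup>2) \<partial>count_space (UNIV :: int set))"
  proof eventually_elim
    case (elim x)
    define n0 where "n0 = \<lfloor>(x - a) / T\<rfloor>"
    have zero: "?h (x - (of_int n * T + a)) x = 0" if "n \<noteq> n0" for n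
    proof -
      have "\<not> (of_int n \<le> (x - a) / T \<and> (x - a) / T < of_int n + 1)"
        using that unfolding n0_def by linarith
      then have "x - (of_int n * T + a) \<notin> {0..<T}"
        using \<open>T > 0\<close> by (auto simp: field_simps)
      then show ?thesis using elim by blast
    qed
    have "apply_shifted_comb H T a x = (\<Sum>\<^sub>\<infinity>n\<in>{n0}. ?h (x - (of_int n * T + a)) x)"
      unfolding comb by (intro infsum_cong_neutral) (auto simp: zero)
    moreover have "(\<integral>\<^sup>+n. ennreal ((cmod (?h (x - (of_int n * T + a)) x))\<^sup>2) \<partial>count_space (UNIV :: int set))
        = (\<integral>\<^sup>+n. ennreal ((cmod (?h (x - (of_int n0 * T + a)) x))\<^sup>2) * indicator {n0} n \<partial>count_space UNIV)"
      using zero by (intro nn_integral_cong) (auto simp: indicator_def)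
    ultimately show ?case by (simp add: nn_integral_cmult_indicator)
  qed
  then have "(\<integral>\<^sup>+x. ennreal ((cmod (apply_shifted_comb H T a x))\<^sup>2) \<partial>lborel)
      = (\<integral>\<^sup>+x. (\<integral>\<^sup>+n. ennreal ((cmod (?h (x - (of_int n * T + a)) x))\<^sup>2) \<partial>count_space (UNIV :: int set)) \<partial>lborel)"
    by (rule nn_integral_cong_AE)
  also have "\<dots> = (\<integral>\<^sup>+n. (\<integral>\<^sup>+x. ennreal ((cmod (?h (x - (of_int n * T + a)) x))\<^sup>2) \<partial>lborel) \<partial>count_space (UNIV :: int set))"
    by (rule nn_integral_count_space_swap[OF sf]) measurable
  also have "\<dots> = (\<integral>\<^sup>+n. (\<integral>\<^sup>+t. ennreal ((cmod (?h t (t + (of_int n * T + a))))\<^sup>2) \<partial>lborel) \<partial>count_space (UNIV :: int set))"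
  proof (rule nn_integral_cong)
    fix n :: int
    show "(\<integral>\<^sup>+x. ennreal ((cmod (?h (x - (of_int n * T + a)) x))\<^sup>2) \<partial>lborel)
        = (\<integral>\<^sup>+t. ennreal ((cmod (?h t (t + (of_int n * T + a))))\<^sup>2) \<partial>lborel)"
      by (subst nn_integral_real_affine[of _ 1 "of_int n * T + a"]) (auto simp: add.commute)
  qed
  also have "\<dots> = (\<integral>\<^sup>+t. (\<integral>\<^sup>+n. ennreal ((cmod (?h t (t + (of_int n * T + a))))\<^sup>2) \<partial>count_space (UNIV :: int set)) \<partial>lborel)"
    by (rule nn_integral_count_space_swap[OF sf, symmetric]) measurable
  finally show "(\<integral>\<^sup>+x. ennreal ((cmod (apply_shifted_comb H T a x))\<^sup>2) \<partial>lborel)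
      = (\<integral>\<^sup>+t. (\<integral>\<^sup>+n. ennreal ((cmod (?h t (t + (of_int n * T + a))))\<^sup>2)
          \<partial>count_space (UNIV :: int set)) \<partial>lborel)" .
qed

text \<open>Membership of the comb responses in \<open>L2\<close> is asserted too, because the
  integral in \<open>L2_norm\<close> defaults to 0 on functions that are not square
  integrable.\<close>

theorem theorem5p4:
  fixes M N :: nat and \<alpha> :: "nat \<Rightarrow> real"
  assumes "M \<ge> 1" and "N \<ge> 1"
    and "0 \<le> \<alpha> 1" and "strict_mono_on {1..M * N} \<alpha>" and "\<alpha> (M * N) < real N"
  shows "\<exists>c C :: real. c > 0 \<and> C > 0 \<and>
    (\<forall>H \<in> OPW ({0..real N} \<times> {- (real M / 2)..real M / 2}).
      (\<forall>j \<in> {1..M * N}. apply_shifted_comb H (real N) (\<alpha> j) \<in> L2 lborel) \<and>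
      c * (HS_norm H)\<^sup>2
        \<le> (\<Sum>j = 1..M * N. (L2_norm lborel (apply_shifted_comb H (real N) (\<alpha> j)))\<^sup>2) \<and>
      (\<Sum>j = 1..M * N. (L2_norm lborel (apply_shifted_comb H (real N) (\<alpha> j)))\<^sup>2)
        \<le> C * (HS_norm H)\<^sup>2)"
proof -
  let ?J = "{1..M * N}" and ?B = "{- (real M / 2)..real M / 2}"
  have range: "0 \<le> \<alpha> j \<and> \<alpha> j < real N" if "j \<in> ?J" for j
  proof -
    have "\<alpha> 1 \<le> \<alpha> j" "\<alpha> j \<le> \<alpha> (M * N)"
      using that strict_mono_on_leD[OF assms(4)] by auto
    then show ?thesis using assms(3,5) by linarith
  qed
  have "inj_on \<alpha> ?J" using assms(4) by (rule strict_mono_on_imp_inj_on)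
  from sampling_bounds[OF \<open>N \<ge> 1\<close> _ _ this range, of M] obtain c C where cC: "c > 0" "C > 0"
    and sampling: "\<And>t F. F \<in> borel_measurable borel \<Longrightarrow>
      (\<integral>\<^sup>+\<nu>. ennreal ((cmod (F \<nu>))\<^sup>2) \<partial>lborel) < \<infinity> \<Longrightarrow>
      (AE \<nu> in lborel. \<nu> \<notin> ?B \<longrightarrow> F \<nu> = 0) \<Longrightarrow>
      ennreal c * (\<integral>\<^sup>+\<nu>. ennreal ((cmod (F \<nu>))\<^sup>2) \<partial>lborel)
        \<le> (\<Sum>j\<in>?J. \<integral>\<^sup>+n. ennreal ((cmod (LINT \<nu>|lborel. F \<nu> *
            cis (2 * pi * (t + (of_int n * real N + \<alpha> j)) * \<nu>)))\<^sup>2) \<partial>count_space (UNIV :: int set)) \<and>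
      (\<Sum>j\<in>?J. \<integral>\<^sup>+n. ennreal ((cmod (LINT \<nu>|lborel. F \<nu> *
            cis (2 * pi * (t + (of_int n * real N + \<alpha> j)) * \<nu>)))\<^sup>2) \<partial>count_space (UNIV :: int set))
        \<le> ennreal C * (\<integral>\<^sup>+\<nu>. ennreal ((cmod (F \<nu>))\<^sup>2) \<partial>lborel)"
    by auto
  have "(\<forall>j\<in>?J. apply_shifted_comb H (real N) (\<alpha> j) \<in> L2 lborel) \<and>
      c * (HS_norm H)\<^sup>2 \<le> (\<Sum>j\<in>?J. (L2_norm lborel (apply_shifted_comb H (real N) (\<alpha> j)))\<^sup>2) \<and>
      (\<Sum>j\<in>?J. (L2_norm lborel (apply_shifted_comb H (real N) (\<alpha> j)))\<^sup>2) \<le> C * (HS_norm H)\<^sup>2"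
    if H: "H \<in> OPW ({0..real N} \<times> ?B)" for H
  proof -
    let ?\<eta> = "spreading_function H" and ?h = "cont_impulse_response H"
    let ?A = "\<lambda>j. apply_shifted_comb H (real N) (\<alpha> j)"
    have "H \<in> HS" and \<eta>: "has_spreading_function H ?\<eta>"
      using H has_spreading_function_spreading_function by (auto simp: OPW_def)
    then have meas [measurable]: "?\<eta> \<in> borel_measurable borel"
      by (auto simp: has_spreading_function_def L2_def)
    have h_eq: "?h t x = (LINT \<nu>|lborel. ?\<eta> (t, \<nu>) * cis (2 * pi * x * \<nu>))" for t x
      by (simp add: cont_impulse_response_def exp_eq_cis)
    have h_meas: "(\<lambda>(t, x). ?h t x) \<in> borel_measurable borel"
      by (rule borel_measurable_cont_impulse_response[OF meas])
    have h_shift [measurable]: "(\<lambda>t. ?h t (t + b)) \<in> borel_measurable borel" for b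
      using measurable_compose[OF _ h_meas, of "\<lambda>t. (t, t + b)" borel] by simp
    \<comment> \<open>Here the whole slice of the spreading function vanishes almost everywhere, so
      its inverse Fourier integral is 0 at every \<open>x\<close>, with an exceptional set of
      \<open>t\<close> that does not depend on \<open>x\<close>.\<close>
    have "AE t in lborel. t \<notin> {0..real N} \<longrightarrow> (\<forall>x. ?h t x = 0)"
      using OPW_spreading_zero[OF H]
    proof eventually_elim
      case (elim t)
      show ?case
      proof (intro impI allI)
        fix x assume "t \<notin> {0..real N}"
        then have "AE \<nu> in lborel. ?\<eta> (t, \<nu>) * cis (2 * pi * x * \<nu>) = 0"
          using elim by (auto elim!: eventually_mono)
        then show "?h t x = 0" unfolding h_eq by (rule integral_eq_zero_AE)
      qed
    qed
    note comb = apply_shifted_comb_nn_integral[OF meas _ this]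
    define E where "E t = (\<integral>\<^sup>+\<nu>. ennreal ((cmod (?\<eta> (t, \<nu>)))\<^sup>2) \<partial>lborel)" for t
    define S where "S t = (\<Sum>j\<in>?J. \<integral>\<^sup>+n. ennreal ((cmod (?h t (t + (of_int n * real N + \<alpha> j))))\<^sup>2)
        \<partial>count_space (UNIV :: int set))" for t
    have [measurable]: "E \<in> borel_measurable borel" unfolding E_def by measurable
    have HS_E: "ennreal ((HS_norm H)\<^sup>2) = (\<integral>\<^sup>+t. E t \<partial>lborel)"
      unfolding E_def by (rule HS_norm_eq_spreading[OF \<open>H \<in> HS\<close> \<eta>])
    have sum_S: "(\<Sum>j\<in>?J. \<integral>\<^sup>+x. ennreal ((cmod (?A j x))\<^sup>2) \<partial>lborel) = (\<integral>\<^sup>+t. S t \<partial>lborel)"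
      unfolding S_def using \<open>N \<ge> 1\<close>
      by (subst nn_integral_sum) (auto intro!: borel_measurable_nn_integral_count_space simp: comb(2))
    have "AE t in lborel. has_L2_fourier (impulse_response H t) (\<lambda>\<nu>. ?\<eta> (t, \<nu>))"
      using \<eta> by (simp add: has_spreading_function_def)
    \<comment> \<open>The sampling bounds apply slice by slice; since \<open>c\<close> and
      \<open>C\<close> are independent of \<open>t\<close>, the inequalities can be
      integrated.\<close>
    then have "AE t in lborel. ennreal c * E t \<le> S t \<and> S t \<le> ennreal C * E t"
      using OPW_spreading_zero[OF H]
    proof eventually_elim
      case (elim t)
      have "AE \<nu> in lborel. \<nu> \<notin> ?B \<longrightarrow> ?\<eta> (t, \<nu>) = 0"
        using elim(2) by eventually_elim auto
      moreover have "(\<lambda>\<nu>. ?\<eta> (t, \<nu>)) \<in> L2 lborel"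
        using elim(1) by (simp add: has_L2_fourier_def)
      ultimately show ?case
        unfolding E_def S_def h_eq
        by (intro sampling L2_nn_integral_finite) (auto simp: L2_def)
    qed
    then have "(\<integral>\<^sup>+t. ennreal c * E t \<partial>lborel) \<le> (\<integral>\<^sup>+t. S t \<partial>lborel)"
      "(\<integral>\<^sup>+t. S t \<partial>lborel) \<le> (\<integral>\<^sup>+t. ennreal C * E t \<partial>lborel)"
      by (auto intro!: nn_integral_mono_AE elim: eventually_mono)
    then have bounds: "ennreal (c * (HS_norm H)\<^sup>2) \<le> (\<integral>\<^sup>+t. S t \<partial>lborel)"
      "(\<integral>\<^sup>+t. S t \<partial>lborel) \<le> ennreal (C * (HS_norm H)\<^sup>2)"
      using cC by (simp_all add: nn_integral_cmult HS_E[symmetric] ennreal_mult')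
    \<comment> \<open>The upper bound makes the sum of squared norms finite, and each summand is at
      most the sum. After this the nonnegative integrals can be read as values of
      \<open>L2_norm\<close>.\<close>
    have L2: "?A j \<in> L2 lborel" if "j \<in> ?J" for j
    proof -
      have "(\<integral>\<^sup>+x. ennreal ((cmod (?A j x))\<^sup>2) \<partial>lborel) \<le> (\<integral>\<^sup>+t. S t \<partial>lborel)"
        unfolding sum_S[symmetric] using that by (intro member_le_sum) auto
      also have "\<dots> < \<infinity>" using bounds(2) by (auto intro: le_less_trans)
      finally have fin: "(\<integral>\<^sup>+x. ennreal ((cmod (?A j x))\<^sup>2) \<partial>lborel) < \<infinity>" .
      have [measurable]: "?A j \<in> borel_measurable borel"
        using comb(1) \<open>N \<ge> 1\<close> by simp
      show ?thesis
        using fin by (auto simp: L2_def less_top intro!: integrableI_nonneg)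
    qed
    have "(\<integral>\<^sup>+t. S t \<partial>lborel) = (\<Sum>j\<in>?J. ennreal ((L2_norm lborel (?A j))\<^sup>2))"
      unfolding sum_S[symmetric] using L2 by (intro sum.cong) (auto simp: L2_norm_nn_integral)
    also have "\<dots> = ennreal (\<Sum>j\<in>?J. (L2_norm lborel (?A j))\<^sup>2)"
      by (rule sum_ennreal) simp
    finally show ?thesis
      using bounds L2 cC by (simp add: ennreal_le_iff sum_nonneg)
  qed
  then show ?thesis using cC by (intro exI[of _ c] exI[of _ C]) blast
qed

end
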